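(* Let $n\ge 1$ and let $z_1,\dots,z_n\in\mathbb{C}$. The elements $\beta^+_{k,l},\beta^-_{k,l}\in\mathbb{C}[\mathfrak{S}_n]$ ($0\le k,l\le n$) all commute pairwise (for all combinations of signs). Furthermore, $$\mathcal{B}^-_n(z_1,\dots,z_n)=\mathcal{B}^+_n(z_1,\dots,z_n)=\mathcal{B}_n(z_1,\dots,z_n),$$ where $\mathcal{B}^-_n(z_1,\dots,z_n)$ is the subalgebra of $\mathbb{C}[\mathfrak{S}_n]$ generated by all the $\beta^-_{k,l}$, $\mathcal{B}^+_n(z_1,\dots,z_n)$ is the subalgebra generated by all the $\beta^+_{k,l}$, and $\mathcal{B}_n(z_1,\dots,z_n)$ is the subalgebra generated by all the $\beta^-_{k,l}$ and all the $\beta^+_{k,l}$ together.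
   Context: $\mathfrak{S}_n$ is the symmetric group on $[n]=\{1,\dots,n\}$. For $X\subseteq[n]$: $z_X=\prod_{i\in X}z_i$; $\mathfrak{S}_X=\{\sigma\in\mathfrak{S}_n\mid\sigma(i)=i\text{ for }i\notin X\}$; $\alpha^+_X=\sum_{\sigma\in\mathfrak{S}_X}\sigma$ and $\alpha^-_X=\sum_{\sigma\in\mathfrak{S}_X}\mathrm{sgn}(\sigma)\,\sigma$ in $\mathbb{C}[\mathfrak{S}_n]$. For $0\le k,l\le n$, $\beta^\pm_{k,l}=\sum_{|X|=k,\ |Y|=l,\ X\cap Y=\emptyset}\alpha^\pm_X\,z_Y$, the sum being over pairs of disjoint subsets $X,Y\subseteq[n]$. *)

theory Defs
  imports
    Complex_Main
    "HOL-Library.Poly_Mapping"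
    "HOL-Combinatorics.Perm"
    "HOL-Combinatorics.Permutations"
begin

unbundle permutation_syntax

text \<open>
  The convolution product of \<^theory>\<open>HOL-Library.Poly_Mapping\<close> is available for keys of class
  \<^class>\<open>monoid_add\<close>, whereas permutations carry their group structure multiplicatively.
  Reading composition also as a (non-commutative) addition turns \<^typ>\<open>nat perm \<Rightarrow>\<^sub>0 complex\<close>
  into the group algebra of the finitely supported permutations of the natural numbers.
\<close>

instantiation perm :: (type) monoid_add
begin

definition zero_perm :: "'a perm" where
  "zero_perm = 1"

definition plus_perm :: "'a perm \<Rightarrow> 'a perm \<Rightarrow> 'a perm" where
  "plus_perm \<sigma> \<tau> = \<sigma> * \<tau>"

instance
  by standard (simp_all add: zero_perm_def plus_perm_def mult.assoc)

end

lemma single_perm_mult: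
  fixes \<sigma> \<tau> :: "'a perm"
  shows "Poly_Mapping.single \<sigma> a * Poly_Mapping.single \<tau> b = Poly_Mapping.single (\<sigma> * \<tau>) (a * b)"
  by (simp add: mult_single plus_perm_def)

lemma one_eq_single_perm: "(1 :: 'a perm \<Rightarrow>\<^sub>0 complex) = Poly_Mapping.single 1 1"
  by (metis single_one zero_perm_def)

definition sym_group :: "nat set \<Rightarrow> nat perm set" where
  "sym_group X = {\<sigma>. \<forall>i. i \<notin> X \<longrightarrow> \<sigma> \<langle>$\<rangle> i = i}"

definition group_algebra :: "nat \<Rightarrow> (nat perm \<Rightarrow>\<^sub>0 complex) set" where
  "group_algebra n = {a. Poly_Mapping.keys a \<subseteq> sym_group {1..n}}"

abbreviation scale :: "complex \<Rightarrow> (nat perm \<Rightarrow>\<^sub>0 complex) \<Rightarrow> (nat perm \<Rightarrow>\<^sub>0 complex)" where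
  "scale c a \<equiv> Poly_Mapping.map ((*) c) a"

definition subalgebra :: "nat \<Rightarrow> (nat perm \<Rightarrow>\<^sub>0 complex) set \<Rightarrow> bool" where
  "subalgebra n A \<longleftrightarrow>
     A \<subseteq> group_algebra n \<and> 1 \<in> A \<and>
     (\<forall>a\<in>A. \<forall>b\<in>A. a + b \<in> A) \<and>
     (\<forall>a\<in>A. \<forall>b\<in>A. a * b \<in> A) \<and>
     (\<forall>c. \<forall>a\<in>A. scale c a \<in> A)"

definition generated_subalgebra ::
  "nat \<Rightarrow> (nat perm \<Rightarrow>\<^sub>0 complex) set \<Rightarrow> (nat perm \<Rightarrow>\<^sub>0 complex) set" where
  "generated_subalgebra n G = subalgebra n hull G"

definition alpha_plus :: "nat set \<Rightarrow> nat perm \<Rightarrow>\<^sub>0 complex" where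
  "alpha_plus X = (\<Sum>\<sigma>\<in>sym_group X. Poly_Mapping.single \<sigma> 1)"

definition alpha_minus :: "nat set \<Rightarrow> nat perm \<Rightarrow>\<^sub>0 complex" where
  "alpha_minus X = (\<Sum>\<sigma>\<in>sym_group X. Poly_Mapping.single \<sigma> (of_int (sign ((\<langle>$\<rangle>) \<sigma>))))"

definition disjoint_pairs :: "nat \<Rightarrow> nat \<Rightarrow> nat \<Rightarrow> (nat set \<times> nat set) set" where
  "disjoint_pairs n k l =
     {(X, Y). X \<subseteq> {1..n} \<and> Y \<subseteq> {1..n} \<and> card X = k \<and> card Y = l \<and> X \<inter> Y = {}}"

definition beta_plus :: "nat \<Rightarrow> (nat \<Rightarrow> complex) \<Rightarrow> nat \<Rightarrow> nat \<Rightarrow> nat perm \<Rightarrow>\<^sub>0 complex" where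
  "beta_plus n z k l = (\<Sum>(X, Y)\<in>disjoint_pairs n k l. scale (\<Prod>i\<in>Y. z i) (alpha_plus X))"

definition beta_minus :: "nat \<Rightarrow> (nat \<Rightarrow> complex) \<Rightarrow> nat \<Rightarrow> nat \<Rightarrow> nat perm \<Rightarrow>\<^sub>0 complex" where
  "beta_minus n z k l = (\<Sum>(X, Y)\<in>disjoint_pairs n k l. scale (\<Prod>i\<in>Y. z i) (alpha_minus X))"

definition betas_plus :: "nat \<Rightarrow> (nat \<Rightarrow> complex) \<Rightarrow> (nat perm \<Rightarrow>\<^sub>0 complex) set" where
  "betas_plus n z = {beta_plus n z k l |k l. k \<le> n \<and> l \<le> n}"

definition betas_minus :: "nat \<Rightarrow> (nat \<Rightarrow> complex) \<Rightarrow> (nat perm \<Rightarrow>\<^sub>0 complex) set" where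
  "betas_minus n z = {beta_minus n z k l |k l. k \<le> n \<and> l \<le> n}"

definition B_plus :: "nat \<Rightarrow> (nat \<Rightarrow> complex) \<Rightarrow> (nat perm \<Rightarrow>\<^sub>0 complex) set" where
  "B_plus n z = generated_subalgebra n (betas_plus n z)"

definition B_minus :: "nat \<Rightarrow> (nat \<Rightarrow> complex) \<Rightarrow> (nat perm \<Rightarrow>\<^sub>0 complex) set" where
  "B_minus n z = generated_subalgebra n (betas_minus n z)"

definition B_all :: "nat \<Rightarrow> (nat \<Rightarrow> complex) \<Rightarrow> (nat perm \<Rightarrow>\<^sub>0 complex) set" where
  "B_all n z = generated_subalgebra n (betas_minus n z \<union> betas_plus n z)"

text \<open>
  The sums above range over finite sets, and the generators lie in the group algebra, so that the
  intersection defining the hull is over a nonempty family.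
\<close>

lemma finite_sym_group:
  assumes "finite X"
  shows "finite (sym_group X)"
proof -
  have "(\<langle>$\<rangle>) ` sym_group X \<subseteq> {p. p permutes X}"
    by (auto simp: sym_group_def permutes_def) (metis bij_apply bij_pointE)+
  moreover have "inj_on (\<langle>$\<rangle>) (sym_group X)"
    by (rule inj_onI) (simp add: apply_inject)
  ultimately show ?thesis
    by (metis assms finite_imageD finite_permutations finite_subset)
qed

lemma finite_disjoint_pairs: "finite (disjoint_pairs n k l)"
  by (rule finite_subset[of _ "Pow {1..n} \<times> Pow {1..n}"]) (auto simp: disjoint_pairs_def)

lemma group_algebra_sum:
  "(\<And>x. x \<in> A \<Longrightarrow> f x \<in> group_algebra n) \<Longrightarrow> sum f A \<in> group_algebra n"
proof (induction A rule: infinite_finite_induct)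
  case (insert x F)
  then show ?case
    using keys_add[of "f x" "sum f F"] by (auto simp: group_algebra_def)
qed (auto simp: group_algebra_def)

lemma group_algebra_scale: "a \<in> group_algebra n \<Longrightarrow> scale c a \<in> group_algebra n"
  by (auto simp: group_algebra_def in_keys_iff map.rep_eq when_def split: if_splits)

lemma group_algebra_single: "\<sigma> \<in> sym_group {1..n} \<Longrightarrow> Poly_Mapping.single \<sigma> c \<in> group_algebra n"
  by (auto simp: group_algebra_def)

lemma sym_group_mono: "X \<subseteq> Y \<Longrightarrow> sym_group X \<subseteq> sym_group Y"
  by (auto simp: sym_group_def)

lemma beta_plus_in_group_algebra: "beta_plus n z k l \<in> group_algebra n"
  unfolding beta_plus_def alpha_plus_def disjoint_pairs_def
  by (auto intro!: group_algebra_sum group_algebra_scale group_algebra_single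
      dest: subsetD[OF sym_group_mono])

lemma beta_minus_in_group_algebra: "beta_minus n z k l \<in> group_algebra n"
  unfolding beta_minus_def alpha_minus_def disjoint_pairs_def
  by (auto intro!: group_algebra_sum group_algebra_scale group_algebra_single
      dest: subsetD[OF sym_group_mono])

lemma subalgebra_group_algebra: "subalgebra n (group_algebra n)"
proof -
  have "a + b \<in> group_algebra n" if "a \<in> group_algebra n" "b \<in> group_algebra n" for a b
    using that keys_add[of a b] by (auto simp: group_algebra_def)
  moreover have "a * b \<in> group_algebra n" if "a \<in> group_algebra n" "b \<in> group_algebra n" for a b
    using that keys_mult[of a b]
    by (fastforce simp: group_algebra_def sym_group_def plus_perm_def apply_times)
  moreover have "1 \<in> group_algebra n"
    by (auto simp: one_eq_single_perm sym_group_def intro!: group_algebra_single)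
  ultimately show ?thesis
    by (auto simp: subalgebra_def intro: group_algebra_scale)
qed

lemma subalgebra_generated_subalgebra:
  assumes "G \<subseteq> group_algebra n"
  shows "subalgebra n (generated_subalgebra n G)"
  unfolding generated_subalgebra_def hull_def
  using assms subalgebra_group_algebra[of n]
  by (subst subalgebra_def) (auto simp: subalgebra_def)

end

theory Submission
  imports
    Defs
    "HOL-Computational_Algebra.Polynomial"
begin

text \<open>
  Put \<open>\<beta>\<^sup>\<plusminus>\<^sub>k(u) = \<Sum>\<^bsub>|X|=k\<^esub> \<alpha>\<^sup>\<plusminus>\<^sub>X \<Prod>\<^bsub>i\<notin>X\<^esub> (u + z\<^sub>i)\<close>; its coefficients in \<open>u\<close> are the
  \<open>\<beta>\<^sup>\<plusminus>\<^bsub>k,l\<^esub>\<close>, so by interpolation one may work with the values \<open>\<beta>\<^sup>\<plusminus>\<^sub>k(u)\<close>.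

  Equal signs commute: the coefficient of \<open>\<pi>\<close> in \<open>\<alpha>\<^sub>X \<alpha>\<^sub>Y\<close> is (up to the sign of \<open>\<pi>\<close>) \<open>|X \<inter> Y|!\<close> if
  \<open>\<pi>\<close> fixes the complement of \<open>X \<union> Y\<close> and maps no element of \<open>X - Y\<close> into \<open>Y - X\<close>, and \<open>0\<close> otherwise.
  Hence the coefficient of \<open>\<pi>\<close> in \<open>\<beta>\<^sub>k(u) \<beta>\<^sub>l(v)\<close> is a partition function of two-state transfer matrices
  placed along the cycles of \<open>\<pi>\<close>, and the one in \<open>\<beta>\<^sub>l(v) \<beta>\<^sub>k(u)\<close> is the same with transposed matrices. As
  \<open>(u + z\<^sub>i) - (v + z\<^sub>i)\<close> does not depend on \<open>i\<close>, a single matrix conjugates all of them to their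
  transposes.

  Opposite signs: \<open>\<alpha>\<^sup>-\<^sub>X \<alpha>\<^sup>+\<^sub>Y = 0\<close> when \<open>|X \<inter> Y| \<ge> 2\<close>, and for disjoint \<open>W\<close>, \<open>V\<close> the element
  \<open>(|W| + |V|) \<alpha>\<^sup>-\<^sub>W \<alpha>\<^sup>+\<^sub>V\<close> is the sum of the products \<open>\<alpha>\<^sup>-\<^bsub>W+j\<^esub> \<alpha>\<^sup>+\<^sub>V\<close> (\<open>j \<in> V\<close>) and \<open>\<alpha>\<^sup>-\<^sub>W \<alpha>\<^sup>+\<^bsub>V+j\<^esub>\<close> (\<open>j \<in> W\<close>).
  So in the alternating sum of the \<open>\<beta>\<^sup>-\<^sub>k(u) \<beta>\<^sup>+\<^bsub>m-k\<^esub>(v)\<close> the terms with disjoint supports, times \<open>m\<close>, are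
  \<open>v - u\<close> times the terms of degree \<open>m + 1\<close> with supports meeting in one point. The latter
  therefore lie in \<open>\<B>\<^sup>-\<close> by the relation one degree lower, divided by \<open>v - u\<close>, and setting \<open>u = v\<close>
  expresses \<open>\<beta>\<^sup>+\<^sub>m(v)\<close> through the \<open>\<beta>\<^sup>-\<close> and lower \<open>\<beta>\<^sup>+\<close>; by induction \<open>\<B>\<^sup>+ \<subseteq> \<B>\<^sup>-\<close>, and symmetrically. Mixed
  commutativity is then a consequence.
\<close>

section \<open>Interpolation and sums along permutations\<close>

lemma lagrange_basis:
  fixes T :: "'a::field set"
  assumes "finite T"
  obtains L where "\<And>q. degree q < card T \<Longrightarrow> q = (\<Sum>t\<in>T. smult (poly q t) (L t))"
proof
  define M where "M t = (\<Prod>s\<in>T - {t}. [:-s, 1:])" for t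
  define L where "L t = smult (inverse (poly (M t) t)) (M t)" for t
  have nz: "poly (M t) t \<noteq> 0" for t
    using assms by (auto simp: M_def poly_prod)
  have L: "poly (L t) s = (if s = t then 1 else 0)" if "s \<in> T" "t \<in> T" for s t
    using that assms nz[of t] by (auto simp: L_def M_def poly_prod)
  have deg: "degree (L t) < card T" if "t \<in> T" for t
  proof -
    have "degree (M t) \<le> (\<Sum>s\<in>T - {t}. 1)"
      unfolding M_def by (rule order.trans[OF degree_prod_sum_le]) (use assms in auto)
    moreover have "0 < card T" using that assms by (auto simp: card_gt_0_iff)
    ultimately show ?thesis
      using that assms by (auto simp: L_def card_Diff_singleton split: if_splits)
  qed
  show "q = (\<Sum>t\<in>T. smult (poly q t) (L t))" if "degree q < card T" for q
  proof (rule poly_eqI_degree[of T])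
    show "poly q s = poly (\<Sum>t\<in>T. smult (poly q t) (L t)) s" if "s \<in> T" for s
      using that assms by (simp add: poly_sum L if_distrib sum.delta cong: if_cong)
    show "degree (\<Sum>t\<in>T. smult (poly q t) (L t)) < card T"
    proof (cases "T = {}")
      case False
      have "degree (\<Sum>t\<in>T. smult (poly q t) (L t)) \<le> card T - 1"
        using deg assms by (intro degree_sum_le) (fastforce intro: order.trans[OF degree_smult_le])+
      then show ?thesis using False assms by (simp add: card_gt_0_iff le_less_trans)
    qed (use that in auto)
  qed (use that in auto)
qed

text \<open>Evaluation at \<open>d + 1\<close> distinct points of \<open>A\<close> is an invertible
  (Vandermonde) transformation of the coefficients, so each coefficient is a linear combination of
  values.\<close>

lemma (in vector_space) polynomial_coeff_in_subspace:
  assumes V: "subspace V" and A: "infinite A"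
    and p: "\<And>x. x \<in> A \<Longrightarrow> (\<Sum>i\<le>d. scale (x ^ i) (c i)) \<in> V" and "r \<le> d"
  shows "c r \<in> V"
proof -
  obtain T where T: "T \<subseteq> A" "finite T" "card T = Suc d"
    using infinite_arbitrarily_large[OF A] by blast
  obtain L where L: "\<And>q. degree q < card T \<Longrightarrow> q = (\<Sum>t\<in>T. smult (poly q t) (L t))"
    using lagrange_basis[OF T(2)] by blast
  \<comment> \<open>The coefficients of the Lagrange polynomials invert the Vandermonde matrix:
    interpolate the monomial of degree \<open>i\<close> and compare coefficients of degree
    \<open>r\<close>.\<close>
  have *: "(if i = r then 1 else 0) = (\<Sum>t\<in>T. t ^ i * coeff (L t) r)" if "i \<le> d" for i
  proof -
    have "degree (monom 1 i :: 'a poly) < card T" using that T by (simp add: degree_monom_eq)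
    from arg_cong[OF L[OF this], of "\<lambda>q. coeff q r"] show ?thesis
      by (simp add: coeff_sum poly_monom)
  qed
  have "c r = (\<Sum>i\<le>d. scale (if i = r then 1 else 0) (c i))"
    using \<open>r \<le> d\<close> by (simp add: if_distrib[of "\<lambda>x. scale x _"] sum.delta cong: if_cong)
  also have "\<dots> = (\<Sum>i\<le>d. \<Sum>t\<in>T. scale (coeff (L t) r) (scale (t ^ i) (c i)))"
    by (intro sum.cong) (auto simp: * scale_sum_left mult.commute)
  also have "\<dots> = (\<Sum>t\<in>T. scale (coeff (L t) r) (\<Sum>i\<le>d. scale (t ^ i) (c i)))"
    by (subst sum.swap) (simp add: scale_sum_right)
  also have "\<dots> \<in> V"
    by (rule subspace_sum[OF V], rule subspace_scale[OF V], rule p) (use T in auto)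
  finally show ?thesis .
qed

lemma poly_eq_sum_le:
  fixes p :: "'a::comm_semiring_1 poly"
  assumes "degree p \<le> d"
  shows "poly p x = (\<Sum>i\<le>d. coeff p i * x ^ i)"
  using arg_cong[OF poly_as_sum_of_monoms'[OF assms], of "\<lambda>q. poly q x"]
  by (simp add: poly_sum poly_monom)

text \<open>The coefficients of the vector-valued polynomial lie in \<open>V\<close>, hence so do
  its values everywhere. This fills in the exceptional parameters at which a division is
  impossible.\<close>

lemma (in vector_space) polynomial_value_in_subspace:
  assumes V: "subspace V" and A: "infinite A" and "finite S"
    and p: "\<And>x. x \<in> A \<Longrightarrow> (\<Sum>s\<in>S. scale (poly (q s) x) (c s)) \<in> V"
  shows "(\<Sum>s\<in>S. scale (poly (q s) x) (c s)) \<in> V"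
proof -
  define d where "d = (\<Sum>s\<in>S. degree (q s))"
  have d: "degree (q s) \<le> d" if "s \<in> S" for s
    unfolding d_def using \<open>finite S\<close> that by (intro member_le_sum) auto
  have eq: "(\<Sum>s\<in>S. scale (poly (q s) x) (c s)) =
      (\<Sum>i\<le>d. scale (x ^ i) (\<Sum>s\<in>S. scale (coeff (q s) i) (c s)))" for x
  proof -
    have "(\<Sum>s\<in>S. scale (poly (q s) x) (c s)) =
        (\<Sum>s\<in>S. \<Sum>i\<le>d. scale (x ^ i) (scale (coeff (q s) i) (c s)))"
      by (intro sum.cong refl) (simp add: poly_eq_sum_le[OF d] scale_sum_left mult.commute)
    then show ?thesis by (simp add: scale_sum_right sum.swap[of _ S])
  qed
  have "(\<Sum>s\<in>S. scale (coeff (q s) i) (c s)) \<in> V" if "i \<le> d" for i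
    by (rule polynomial_coeff_in_subspace[OF V A _ that]) (use p eq in auto)
  then show ?thesis
    unfolding eq by (intro subspace_sum[OF V, of "{..d}"]) (simp add: subspace_scale[OF V])
qed

section \<open>Partition functions along the cycles of a permutation\<close>

text \<open>The sum over \<open>e\<close> is the product, over the cycles of \<open>\<pi>\<close>,
  of the traces of the matrices multiplied around the cycle; such traces are invariant under
  conjugation. Summing over \<open>e\<close> first contracts each \<open>Q\<close> with the
  following \<open>R\<close>, so no decomposition into cycles is needed.\<close>

lemma sum_prod_along_permutation_conjugate:
  fixes M M' :: "'i \<Rightarrow> 'c::finite \<Rightarrow> 'c \<Rightarrow> 'a::comm_semiring_1" and Q R :: "'c \<Rightarrow> 'c \<Rightarrow> 'a"
  assumes "finite D" and \<pi>: "\<pi> permutes D"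
    and M': "\<And>i x y. i \<in> D \<Longrightarrow> M' i x y = (\<Sum>u\<in>UNIV. \<Sum>v\<in>UNIV. R x u * M i u v * Q v y)"
    and QR: "\<And>x y. (\<Sum>e\<in>UNIV. Q x e * R e y) = (if x = y then 1 else 0)"
  shows "(\<Sum>e\<in>D \<rightarrow>\<^sub>E UNIV. \<Prod>i\<in>D. M' i (e i) (e (\<pi> i))) =
         (\<Sum>e\<in>D \<rightarrow>\<^sub>E UNIV. \<Prod>i\<in>D. M i (e i) (e (\<pi> i)))"
proof -
  let ?E = "D \<rightarrow>\<^sub>E (UNIV :: 'c set)"
  have fin: "finite ?E" using assms(1) by (intro finite_PiE) auto
  have \<pi>D: "\<pi> i \<in> D \<longleftrightarrow> i \<in> D" for i using permutes_in_image[OF \<pi>] .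
  have sum2: "(\<Prod>i\<in>D. \<Sum>x\<in>UNIV. h i x) = (\<Sum>g\<in>?E. \<Prod>i\<in>D. h i (g i))"
    for h :: "'i \<Rightarrow> 'c \<Rightarrow> 'a"
    using prod_sum_PiE[of D "\<lambda>_. UNIV" h] assms(1) by simp
  have "(\<Sum>e\<in>?E. \<Prod>i\<in>D. M' i (e i) (e (\<pi> i))) =
     (\<Sum>e\<in>?E. \<Sum>u\<in>?E. \<Sum>v\<in>?E. \<Prod>i\<in>D. R (e i) (u i) * M i (u i) (v i) * Q (v i) (e (\<pi> i)))"
    by (intro sum.cong refl) (simp add: M' sum2)
  also have "\<dots> = (\<Sum>u\<in>?E. \<Sum>v\<in>?E. \<Sum>e\<in>?E.
      \<Prod>i\<in>D. R (e i) (u i) * M i (u i) (v i) * Q (v i) (e (\<pi> i)))"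
    by (subst sum.swap, rule sum.cong[OF refl], rule sum.swap)
  also have "\<dots> = (\<Sum>u\<in>?E. \<Sum>v\<in>?E. (\<Prod>i\<in>D. M i (u i) (v i)) * (\<Prod>i\<in>D. if v i = u (\<pi> i) then 1 else 0))"
  proof (intro sum.cong refl)
    fix u v
    have "(\<Sum>e\<in>?E. \<Prod>i\<in>D. R (e i) (u i) * M i (u i) (v i) * Q (v i) (e (\<pi> i))) =
       (\<Prod>i\<in>D. M i (u i) (v i)) * (\<Sum>e\<in>?E. (\<Prod>i\<in>D. R (e i) (u i)) * (\<Prod>i\<in>D. Q (v i) (e (\<pi> i))))"
      by (simp add: prod.distrib sum_distrib_left mult_ac)
    \<comment> \<open>Shifting the index by \<open>\<pi>\<close> brings together the two factors
      that contain \<open>e i\<close>, so that the sum over \<open>e\<close> splits into entries of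
      the matrix product of \<open>Q\<close> and \<open>R\<close>.\<close>
    also have "(\<Sum>e\<in>?E. (\<Prod>i\<in>D. R (e i) (u i)) * (\<Prod>i\<in>D. Q (v i) (e (\<pi> i)))) =
       (\<Sum>e\<in>?E. \<Prod>i\<in>D. Q (v (inv \<pi> i)) (e i) * R (e i) (u i))"
    proof (intro sum.cong refl)
      fix e
      have "(\<Prod>i\<in>D. Q (v i) (e (\<pi> i))) = (\<Prod>i\<in>D. Q (v (inv \<pi> i)) (e i))"
        by (rule prod.reindex_bij_witness[of _ "inv \<pi>" \<pi>])
          (auto simp: permutes_inverses[OF \<pi>] \<pi>D permutes_in_image[OF permutes_inv[OF \<pi>]])
      then show "(\<Prod>i\<in>D. R (e i) (u i)) * (\<Prod>i\<in>D. Q (v i) (e (\<pi> i))) =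
          (\<Prod>i\<in>D. Q (v (inv \<pi> i)) (e i) * R (e i) (u i))"
        by (simp add: prod.distrib mult_ac)
    qed
    also have "\<dots> = (\<Prod>i\<in>D. \<Sum>x\<in>UNIV. Q (v (inv \<pi> i)) x * R x (u i))"
      by (simp add: sum2)
    also have "\<dots> = (\<Prod>i\<in>D. if v (inv \<pi> i) = u i then 1 else 0)"
      by (simp add: QR)
    also have "\<dots> = (\<Prod>i\<in>D. if v i = u (\<pi> i) then 1 else 0)"
      by (rule prod.reindex_bij_witness[of _ \<pi> "inv \<pi>"])
          (auto simp: permutes_inverses[OF \<pi>] \<pi>D permutes_in_image[OF permutes_inv[OF \<pi>]])
    finally show "(\<Sum>e\<in>?E. \<Prod>i\<in>D. R (e i) (u i) * M i (u i) (v i) * Q (v i) (e (\<pi> i))) =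
      (\<Prod>i\<in>D. M i (u i) (v i)) * (\<Prod>i\<in>D. if v i = u (\<pi> i) then 1 else 0)" .
  qed
  also have "\<dots> = (\<Sum>u\<in>?E. \<Prod>i\<in>D. M i (u i) (u (\<pi> i)))"
  proof (intro sum.cong refl)
    fix u assume "u \<in> ?E"
    \<comment> \<open>The Kronecker deltas leave this \<open>v\<close> only; the restriction puts it
      into the extensional function space.\<close>
    define w where "w = restrict (\<lambda>i. u (\<pi> i)) D"
    have w: "w \<in> ?E" by (auto simp: w_def)
    have "(\<Prod>i\<in>D. M i (u i) (v i)) * (\<Prod>i\<in>D. if v i = u (\<pi> i) then 1 else 0) =
        (if v = w then \<Prod>i\<in>D. M i (u i) (u (\<pi> i)) else 0)" if "v \<in> ?E" for v
    proof (cases "v = w")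
      case False
      then have "\<exists>i\<in>D. v i \<noteq> w i"
        using PiE_ext[OF that w] by blast
      then obtain i where "i \<in> D" "v i \<noteq> u (\<pi> i)"
        by (auto simp: w_def)
      then have "(\<Prod>i\<in>D. if v i = u (\<pi> i) then 1 else 0 :: 'a) = 0"
        using assms(1) by (intro prod_zero) auto
      then show ?thesis using False by simp
    qed (simp add: w_def)
    then show "(\<Sum>v\<in>?E. (\<Prod>i\<in>D. M i (u i) (v i)) * (\<Prod>i\<in>D. if v i = u (\<pi> i) then 1 else 0)) =
        (\<Prod>i\<in>D. M i (u i) (u (\<pi> i)))"
      using fin w by simp
  qed
  finally show ?thesis .
qed

text \<open>The shift by \<open>\<sigma>\<close> is kept free because the sums for
  \<open>\<pi>\<close> and for its inverse need different ones, \<open>\<pi>\<close> and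
  \<open>id\<close>.\<close>

lemma sum_bool_functions_eq_sum_Pow:
  assumes "\<sigma> permutes D"
  shows "(\<Sum>e\<in>D \<rightarrow>\<^sub>E UNIV. F {i \<in> D. e (\<sigma> i)}) = (\<Sum>S\<in>Pow D. F S)"
proof (rule sum.reindex_bij_witness[of _ "\<lambda>S. restrict (\<lambda>i. inv \<sigma> i \<in> S) D" "\<lambda>e. {i \<in> D. e (\<sigma> i)}"])
  fix e assume e: "e \<in> D \<rightarrow>\<^sub>E (UNIV :: bool set)"
  show "restrict (\<lambda>i. inv \<sigma> i \<in> {i \<in> D. e (\<sigma> i)}) D = e"
    by (rule PiE_ext[OF _ e])
      (auto simp: permutes_inverses[OF assms] permutes_in_image[OF permutes_inv[OF assms]])
qed (auto simp: permutes_inverses[OF assms] permutes_in_image[OF assms])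

section \<open>Pairs of subsets avoiding a permutation\<close>

text \<open>
  The pairs \<open>(P, S)\<close> are the complements of \<open>X\<close> and \<open>Y\<close> in \<open>D = X \<union> Y\<close>, that is, \<open>P = Y - X\<close> and
  \<open>S = X - Y\<close>.
\<close>

definition avoiding_sum ::
  "'i set \<Rightarrow> ('i \<Rightarrow> 'a) \<Rightarrow> ('i \<Rightarrow> 'a) \<Rightarrow> ('i \<Rightarrow> 'i) \<Rightarrow> nat \<Rightarrow> nat \<Rightarrow> 'a::comm_semiring_1" where
  "avoiding_sum D a b \<pi> p s =
     (\<Sum>S | S \<subseteq> D \<and> card S = s. \<Sum>P | P \<subseteq> D - (S \<union> \<pi> ` S) \<and> card P = p. (\<Prod>i\<in>P. a i) * (\<Prod>i\<in>S. b i))"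

text \<open>Choosing \<open>x * a i\<close> or \<open>1\<close> at each point outside
  \<open>S\<close> and its image produces the sum over \<open>P\<close>, and the powers of
  \<open>x\<close> and \<open>y\<close> record the two cardinalities. Degrees up to
  \<open>card D\<close> exhaust the subsets of \<open>D\<close>.\<close>

lemma avoiding_sum_generating_function:
  fixes a b :: "'i \<Rightarrow> 'a::comm_semiring_1"
  assumes "finite D"
  shows "(\<Sum>S\<in>Pow D. (\<Prod>i\<in>S. y * b i) * (\<Prod>i\<in>D - (S \<union> \<pi> ` S). x * a i + 1)) =
         (\<Sum>p\<le>card D. x ^ p * (\<Sum>s\<le>card D. y ^ s * avoiding_sum D a b \<pi> p s))"
proof -
  let ?E = "\<lambda>S. D - (S \<union> \<pi> ` S)" and ?g = "\<lambda>P S. (\<Prod>i\<in>P. a i) * (\<Prod>i\<in>S. b i)"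
  have fin_Pow: "finite (Pow D)" and fin_Pow': "finite (Pow (?E S))" for S
    using assms by auto
  have card: "card S \<le> card D" if "S \<subseteq> D" for S using assms that by (intro card_mono)
  have avo: "avoiding_sum D a b \<pi> p s =
      (\<Sum>S\<in>Pow D. \<Sum>P\<in>Pow (?E S). (if card S = s then 1 else 0) * (if card P = p then 1 else 0) * ?g P S)"
    for p s
  proof -
    have "avoiding_sum D a b \<pi> p s =
      (\<Sum>S\<in>{S \<in> Pow D. card S = s}. \<Sum>P\<in>{P \<in> Pow (?E S). card P = p}. ?g P S)"
      by (simp add: avoiding_sum_def)
    also have "\<dots> = (\<Sum>S\<in>Pow D. if card S = s then
        \<Sum>P\<in>Pow (?E S). if card P = p then ?g P S else 0 else 0)"
      by (simp only: sum.inter_filter[OF fin_Pow] sum.inter_filter[OF fin_Pow'])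
    also have "\<dots> = (\<Sum>S\<in>Pow D. \<Sum>P\<in>Pow (?E S).
        (if card S = s then 1 else 0) * (if card P = p then 1 else 0) * ?g P S)"
      by (intro sum.cong refl) (auto intro: sum.cong)
    finally show ?thesis .
  qed
  have delta: "(\<Sum>p\<le>card D. x ^ p * (if card P = p then 1 else 0)) = x ^ card P" if "P \<subseteq> D" for P and x :: 'a
  proof -
    have "(\<Sum>p\<le>card D. x ^ p * (if card P = p then 1 else 0)) =
        (\<Sum>p\<le>card D. if card P = p then x ^ p else 0)"
      by (intro sum.cong) auto
    then show ?thesis using card[OF that] by simp
  qed
  have "(\<Sum>p\<le>card D. x ^ p * (\<Sum>s\<le>card D. y ^ s * avoiding_sum D a b \<pi> p s)) =
     (\<Sum>p\<le>card D. \<Sum>s\<le>card D. \<Sum>S\<in>Pow D. \<Sum>P\<in>Pow (?E S).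
        (x ^ p * (if card P = p then 1 else 0)) * (y ^ s * (if card S = s then 1 else 0)) * ?g P S)"
    by (simp add: avo sum_distrib_left mult_ac)
  also have "\<dots> = (\<Sum>S\<in>Pow D. \<Sum>P\<in>Pow (?E S). \<Sum>p\<le>card D. \<Sum>s\<le>card D.
        (x ^ p * (if card P = p then 1 else 0)) * (y ^ s * (if card S = s then 1 else 0)) * ?g P S)"
    by (simp only: sum.swap[of _ "Pow (?E _)" "{..card D}"] sum.swap[of _ "Pow D" "{..card D}"])
  also have "\<dots> = (\<Sum>S\<in>Pow D. \<Sum>P\<in>Pow (?E S). x ^ card P * y ^ card S * ?g P S)"
  proof (intro sum.cong refl)
    fix S P assume "S \<in> Pow D" "P \<in> Pow (?E S)"
    then have "S \<subseteq> D" "P \<subseteq> D" by auto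
    then show "(\<Sum>p\<le>card D. \<Sum>s\<le>card D.
        (x ^ p * (if card P = p then 1 else 0)) * (y ^ s * (if card S = s then 1 else 0)) * ?g P S) =
        x ^ card P * y ^ card S * ?g P S"
      by (simp only: sum_distrib_right[symmetric] sum_distrib_left[symmetric] delta)
  qed
  also have "\<dots> = (\<Sum>S\<in>Pow D. (\<Prod>i\<in>S. y * b i) * (\<Prod>i\<in>?E S. x * a i + 1))"
    using assms by (intro sum.cong refl) (simp add: prod_add prod.distrib sum_distrib_left mult_ac)
  finally show ?thesis by simp
qed

text \<open>Each point of \<open>D\<close> carries a two-by-two matrix whose indices tell whether it
  lies in the image of \<open>S\<close> and whether it lies in \<open>S\<close>. The generating
  function is the partition function of these matrices along \<open>\<pi>\<close>, and inverting
  \<open>\<pi>\<close> transposes them. The conjugating matrix depends only on \<open>x\<close>,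
  \<open>y\<close> and the constant difference \<open>\<delta>\<close>, so it serves all points at
  once.\<close>

lemma avoiding_sum_inv:
  fixes a b :: "'i \<Rightarrow> 'a::field_char_0"
  assumes "finite D" and \<pi>: "\<pi> permutes D" and ab: "\<And>i. i \<in> D \<Longrightarrow> a i = b i + \<delta>"
  shows "avoiding_sum D a b (inv \<pi>) p s = avoiding_sum D a b \<pi> p s"
proof -
  define Z where "Z \<pi> x y =
    (\<Sum>S\<in>Pow D. (\<Prod>i\<in>S. y * b i) * (\<Prod>i\<in>D - (S \<union> \<pi> ` S). x * a i + 1))" for \<pi> x y
  have Z_inv: "Z (inv \<pi>) x y = Z \<pi> x y" if "x \<noteq> 0" "y \<noteq> 0" "\<delta> * (y - x) \<noteq> 1" for x y
  proof -
    \<comment> \<open>\<open>Q\<close> is the symmetric matrix, unique up to scaling, for which every \<open>N i * Q\<close> is symmetric; \<open>R\<close> is its inverse.\<close>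
    define N where "N i u v = (if v then y * b i else if u then 1 else x * a i + 1)" for i u v
    define d where "d = x * y * (\<delta> * (y - x) - 1)"
    define Q where "Q u v = (if u \<and> v then y - x else if u \<or> v then y else y * (x * \<delta> + 1))" for u v
    define R where "R u v = (if u \<and> v then y * (x * \<delta> + 1) else if u \<or> v then - y else y - x) / d" for u v
    \<comment> \<open>\<open>d\<close> is the determinant of \<open>Q\<close>, and the three
      assumptions say exactly that it is nonzero.\<close>
    have "d \<noteq> 0" using that by (simp add: d_def)
    have prodN: "(\<Prod>i\<in>D. if i \<in> S then y * b i else if i \<in> T then 1 else x * a i + 1) =
        (\<Prod>i\<in>S. y * b i) * (\<Prod>i\<in>D - (S \<union> T). x * a i + 1)" if "S \<subseteq> D" for S T
    proof -
      have "(\<Prod>i\<in>D. if i \<in> S then y * b i else if i \<in> T then 1 else x * a i + 1) =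
        (\<Prod>i\<in>S. y * b i) * (\<Prod>i\<in>D - S. if i \<in> T then 1 else x * a i + 1)"
        by (subst prod.subset_diff[OF that assms(1)]) (auto simp: mult.commute intro!: disjI2 prod.cong)
      also have "(\<Prod>i\<in>D - S. if i \<in> T then 1 else x * a i + 1) = (\<Prod>i\<in>D - (S \<union> T). x * a i + 1)"
        using assms(1) by (intro prod.mono_neutral_cong_right) auto
      finally show ?thesis .
    qed
    \<comment> \<open>Here \<open>e\<close> is the indicator of the image of \<open>S\<close>, so
      \<open>e (\<pi> i)\<close> says whether \<open>i\<close> lies in \<open>S\<close>.\<close>
    have "Z \<pi> x y = (\<Sum>e\<in>D \<rightarrow>\<^sub>E UNIV. \<Prod>i\<in>D. N i (e i) (e (\<pi> i)))"
    proof -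
      have "Z \<pi> x y = (\<Sum>e\<in>D \<rightarrow>\<^sub>E UNIV. (\<Prod>i\<in>{i\<in>D. e (\<pi> i)}. y * b i) *
          (\<Prod>i\<in>D - ({i\<in>D. e (\<pi> i)} \<union> \<pi> ` {i\<in>D. e (\<pi> i)}). x * a i + 1))"
        unfolding Z_def by (rule sum_bool_functions_eq_sum_Pow[OF \<pi>, symmetric])
      also have "\<dots> = (\<Sum>e\<in>D \<rightarrow>\<^sub>E UNIV. \<Prod>i\<in>D. N i (e i) (e (\<pi> i)))"
      proof (intro sum.cong refl)
        fix e
        have "\<pi> ` {i\<in>D. e (\<pi> i)} = {i\<in>D. e i}"
          using permutes_image[OF \<pi>] by auto
        then show "(\<Prod>i\<in>{i\<in>D. e (\<pi> i)}. y * b i) *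
          (\<Prod>i\<in>D - ({i\<in>D. e (\<pi> i)} \<union> \<pi> ` {i\<in>D. e (\<pi> i)}). x * a i + 1) = (\<Prod>i\<in>D. N i (e i) (e (\<pi> i)))"
          by (subst prodN[symmetric]) (auto simp: N_def intro!: prod.cong)
      qed
      finally show ?thesis .
    qed
    \<comment> \<open>Now \<open>e\<close> is the indicator of \<open>S\<close> itself, so the
      values \<open>e i\<close> and \<open>e (\<pi> i)\<close> exchange their roles as indices of
      \<open>N i\<close>.\<close>
    moreover have "Z (inv \<pi>) x y = (\<Sum>e\<in>D \<rightarrow>\<^sub>E UNIV. \<Prod>i\<in>D. N i (e (\<pi> i)) (e i))"
    proof -
      have "Z (inv \<pi>) x y = (\<Sum>e\<in>D \<rightarrow>\<^sub>E UNIV. (\<Prod>i\<in>{i\<in>D. e (id i)}. y * b i) *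
          (\<Prod>i\<in>D - ({i\<in>D. e (id i)} \<union> inv \<pi> ` {i\<in>D. e (id i)}). x * a i + 1))"
        unfolding Z_def by (rule sum_bool_functions_eq_sum_Pow[OF permutes_id, symmetric])
      also have "\<dots> = (\<Sum>e\<in>D \<rightarrow>\<^sub>E UNIV. \<Prod>i\<in>D. N i (e (\<pi> i)) (e i))"
      proof (intro sum.cong refl)
        fix e
        have "i \<in> inv \<pi> ` {i\<in>D. e i} \<longleftrightarrow> i \<in> D \<and> e (\<pi> i)" for i
          using permutes_inverses[OF \<pi>] permutes_in_image[OF \<pi>] by (metis (mono_tags, lifting) imageE image_eqI mem_Collect_eq)
        then show "(\<Prod>i\<in>{i\<in>D. e (id i)}. y * b i) *
          (\<Prod>i\<in>D - ({i\<in>D. e (id i)} \<union> inv \<pi> ` {i\<in>D. e (id i)}). x * a i + 1) = (\<Prod>i\<in>D. N i (e (\<pi> i)) (e i))"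
          by (subst prodN[symmetric]) (auto simp: N_def intro!: prod.cong)
      qed
      finally show ?thesis .
    qed
    moreover have "(\<Sum>e\<in>D \<rightarrow>\<^sub>E UNIV. \<Prod>i\<in>D. (\<lambda>i u v. N i v u) i (e i) (e (\<pi> i))) =
        (\<Sum>e\<in>D \<rightarrow>\<^sub>E UNIV. \<Prod>i\<in>D. N i (e i) (e (\<pi> i)))"
    proof (rule sum_prod_along_permutation_conjugate[OF assms(1) \<pi>, of _ R N Q])
      fix i u v assume "i \<in> D"
      \<comment> \<open>Multiplying by \<open>d\<close> turns \<open>R\<close> into the adjugate of
        \<open>Q\<close> and leaves polynomial identities; the constancy of \<open>a i - b i\<close>
        enters here.\<close>
      have "(\<Sum>r\<in>UNIV. \<Sum>t\<in>UNIV. d * R u r * N i r t * Q t v) = d * N i v u"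
        using \<open>d \<noteq> 0\<close>
        by (cases u; cases v) (simp_all add: UNIV_bool R_def Q_def N_def ab[OF \<open>i \<in> D\<close>], simp_all add: d_def algebra_simps)
      then have "d * (\<Sum>r\<in>UNIV. \<Sum>t\<in>UNIV. R u r * N i r t * Q t v) = d * N i v u"
        by (simp add: sum_distrib_left mult_ac)
      then show "N i v u = (\<Sum>r\<in>UNIV. \<Sum>t\<in>UNIV. R u r * N i r t * Q t v)"
        using \<open>d \<noteq> 0\<close> by simp
    next
      fix u v
      have "(\<Sum>e\<in>UNIV. Q u e * (d * R e v)) = (if u = v then d else 0)"
        using \<open>d \<noteq> 0\<close>
        by (cases u; cases v) (simp_all add: UNIV_bool R_def Q_def, simp_all add: d_def algebra_simps)
      then have "d * (\<Sum>e\<in>UNIV. Q u e * R e v) = (if u = v then d else 0)"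
        by (simp add: sum_distrib_left mult_ac)
      then show "(\<Sum>e\<in>UNIV. Q u e * R e v) = (if u = v then 1 else 0)"
        using \<open>d \<noteq> 0\<close> by (auto split: if_splits)
    qed
    ultimately show ?thesis by simp
  qed
  define c where "c p s = avoiding_sum D a b (inv \<pi>) p s - avoiding_sum D a b \<pi> p s" for p s
  interpret K: vector_space "(*) :: 'a \<Rightarrow> 'a \<Rightarrow> 'a"
    by standard (simp_all add: algebra_simps)
  have sub: "K.subspace {0}" by (rule K.subspace_single_0)
  \<comment> \<open>The \<open>c p s\<close> are the coefficients of a polynomial that vanishes off
    finitely many points, first in \<open>x\<close> with \<open>y\<close> fixed, then in
    \<open>y\<close>; interpolation is applied with the zero subspace.\<close>
  have *: "(\<Sum>s\<le>card D. y ^ s * c p s) \<in> {0}" if "y \<noteq> 0" "p \<le> card D" for y p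
  proof (rule K.polynomial_coeff_in_subspace[OF sub _ _ that(2)])
    have "- {x. x \<noteq> 0 \<and> \<delta> * (y - x) \<noteq> 1} \<subseteq> {0, y - 1 / \<delta>}"
      by (cases "\<delta> = 0") (auto simp: field_simps)
    then show "infinite {x. x \<noteq> 0 \<and> \<delta> * (y - x) \<noteq> 1}"
      by (metis finite.emptyI finite_insert finite_subset finite_compl infinite_UNIV_char_0)
    show "(\<Sum>i\<le>card D. x ^ i * (\<Sum>s\<le>card D. y ^ s * c i s)) \<in> {0}"
      if "x \<in> {x. x \<noteq> 0 \<and> \<delta> * (y - x) \<noteq> 1}" for x
      using Z_inv[of x y] that \<open>y \<noteq> 0\<close> unfolding Z_def avoiding_sum_generating_function[OF assms(1)]
      by (simp add: c_def right_diff_distrib sum_subtractf)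
  qed
  have "c p s \<in> {0}" if "p \<le> card D" "s \<le> card D"
  proof (rule K.polynomial_coeff_in_subspace[OF sub _ _ that(2)])
    show "infinite (- {0 :: 'a})"
      by (simp add: finite_compl infinite_UNIV_char_0)
    show "(\<Sum>s\<le>card D. y ^ s * c p s) \<in> {0}" if "y \<in> - {0}" for y
      using * that \<open>p \<le> card D\<close> by simp
  qed
  \<comment> \<open>The generating function only sees \<open>p\<close> and \<open>s\<close> up to
    \<open>card D\<close>; beyond that there are no subsets to sum over.\<close>
  moreover have "avoiding_sum D a b \<pi>' p s = 0" if "\<not> (p \<le> card D \<and> s \<le> card D)" for \<pi>'
  proof -
    have "card T \<le> card D" if "T \<subseteq> D" for T using assms(1) that by (rule card_mono)
    then have "{S. S \<subseteq> D \<and> card S = s} = {} \<or> (\<forall>S. {P. P \<subseteq> D - (S \<union> \<pi>' ` S) \<and> card P = p} = {})"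
      using that by blast
    then show ?thesis
      unfolding avoiding_sum_def by (elim disjE) (simp_all only: sum.empty sum.neutral_const simp_thms)
  qed
  ultimately show ?thesis by (cases "p \<le> card D \<and> s \<le> card D") (auto simp: c_def)
qed

section \<open>The group algebra and products of symmetrizers\<close>

lemma lookup_scale: "Poly_Mapping.lookup (scale c a) \<sigma> = c * Poly_Mapping.lookup a \<sigma>"
  by (simp add: map.rep_eq when_def)

interpretation group_algebra: vector_space scale
  by standard (auto intro!: poly_mapping_eqI simp: lookup_scale lookup_add algebra_simps)

lemma poly_mapping_eq_sum_single:
  "a = (\<Sum>k\<in>Poly_Mapping.keys a. Poly_Mapping.single k (Poly_Mapping.lookup a k))"
  by (rule poly_mapping_eqI) (auto simp: lookup_sum lookup_single when_def in_keys_iff)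

lemma scale_single: "scale c (Poly_Mapping.single \<sigma> d) = Poly_Mapping.single \<sigma> (c * d)"
  by (rule poly_mapping_eqI) (auto simp: lookup_scale lookup_single when_def)

lemma scale_mult_left: "scale c a * b = scale c (a * b)"
proof -
  have "scale c (\<Sum>k\<in>S. Poly_Mapping.single k (f k)) * (\<Sum>k\<in>T. Poly_Mapping.single k (g k)) =
      scale c ((\<Sum>k\<in>S. Poly_Mapping.single k (f k)) * (\<Sum>k\<in>T. Poly_Mapping.single k (g k)))"
    for S T :: "nat perm set" and f g
    by (simp add: group_algebra.scale_sum_right sum_product scale_single single_perm_mult mult.assoc)
  from this[of "Poly_Mapping.lookup a" "Poly_Mapping.keys a" "Poly_Mapping.lookup b" "Poly_Mapping.keys b"]
  show ?thesis by (simp only: poly_mapping_eq_sum_single[symmetric])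
qed

lemma scale_mult_right: "a * scale c b = scale c (a * b)"
proof -
  have "(\<Sum>k\<in>S. Poly_Mapping.single k (f k)) * scale c (\<Sum>k\<in>T. Poly_Mapping.single k (g k)) =
      scale c ((\<Sum>k\<in>S. Poly_Mapping.single k (f k)) * (\<Sum>k\<in>T. Poly_Mapping.single k (g k)))"
    for S T :: "nat perm set" and f g
    by (simp add: group_algebra.scale_sum_right sum_product scale_single single_perm_mult mult.left_commute)
  from this[of "Poly_Mapping.lookup a" "Poly_Mapping.keys a" "Poly_Mapping.lookup b" "Poly_Mapping.keys b"]
  show ?thesis by (simp only: poly_mapping_eq_sum_single[symmetric])
qed

section \<open>Symmetric groups on subsets\<close>

lemma sym_group_iff_permutes: "\<sigma> \<in> sym_group X \<longleftrightarrow> (\<langle>$\<rangle>) \<sigma> permutes X"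
  by (auto simp: sym_group_def permutes_def) (metis bij_apply bij_pointE)+

lemma sym_group_mult: "\<sigma> \<in> sym_group X \<Longrightarrow> \<tau> \<in> sym_group X \<Longrightarrow> \<sigma> * \<tau> \<in> sym_group X"
  by (simp add: sym_group_def apply_times)

lemma perm_mult_inverse_cancel [simp]:
  fixes \<sigma> :: "'a perm"
  shows "inverse \<sigma> * (\<sigma> * \<tau>) = \<tau>" "\<sigma> * (inverse \<sigma> * \<tau>) = \<tau>"
    "\<tau> * inverse \<sigma> * \<sigma> = \<tau>" "\<tau> * \<sigma> * inverse \<sigma> = \<tau>"
  by (simp_all flip: mult.assoc) (simp_all add: mult.assoc)

lemma sym_group_inverse: "\<sigma> \<in> sym_group X \<Longrightarrow> inverse \<sigma> \<in> sym_group X"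
  by (simp add: sym_group_iff_permutes apply_inverse permutes_inv)

lemma sym_group_inverse_iff: "inverse \<sigma> \<in> sym_group X \<longleftrightarrow> \<sigma> \<in> sym_group X"
  by (metis sym_group_inverse inverse_perm.rep_eq bij_apply inv_inv_eq apply_inject)

lemma sym_group_Int: "sym_group X \<inter> sym_group Y = sym_group (X \<inter> Y)"
  by (auto simp: sym_group_def)

lemma perm_of_permutes:
  assumes "p permutes X" "finite X"
  obtains \<sigma> where "\<sigma> \<in> sym_group X" "(\<langle>$\<rangle>) \<sigma> = p"
proof -
  have "{a. p a \<noteq> a} \<subseteq> X" using assms(1) by (auto simp: permutes_def)
  then have "(\<langle>$\<rangle>) (Perm p) = p"
    using assms by (intro Perm_inverse) (auto intro: finite_subset permutes_bij)
  then show thesis using assms(1) that[of "Perm p"] by (simp add: sym_group_iff_permutes)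
qed

lemma card_sym_group:
  assumes "finite X"
  shows "card (sym_group X) = fact (card X)"
proof -
  have "bij_betw (\<langle>$\<rangle>) (sym_group X) {p. p permutes X}"
    using perm_of_permutes[OF _ assms]
    by (fastforce simp: bij_betw_def inj_on_def apply_inject sym_group_iff_permutes)
  then show ?thesis using card_permutations[OF refl assms] by (simp add: bij_betw_same_card)
qed

section \<open>Counting factorizations of a permutation\<close>

definition factorizations :: "nat set \<Rightarrow> nat set \<Rightarrow> nat perm \<Rightarrow> (nat perm \<times> nat perm) set" where
  "factorizations X Y \<pi> = {(\<sigma>, \<tau>). \<sigma> \<in> sym_group X \<and> \<tau> \<in> sym_group Y \<and> \<sigma> * \<tau> = \<pi>}"

text \<open>Two factorizations differ by an element of the common subgroup: all of them are
  \<open>(\<sigma> * inverse \<rho>, \<rho> * \<tau>)\<close> with \<open>\<rho>\<close> in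
  \<open>sym_group (X \<inter> Y)\<close>.\<close>

lemma card_factorizations_eq_fact:
  assumes "finite X" "finite Y" "(\<sigma>, \<tau>) \<in> factorizations X Y \<pi>"
  shows "card (factorizations X Y \<pi>) = fact (card (X \<inter> Y))"
proof -
  have \<sigma>\<tau>: "\<sigma> \<in> sym_group X" "\<tau> \<in> sym_group Y" "\<sigma> * \<tau> = \<pi>"
    using assms(3) by (auto simp: factorizations_def)
  have "bij_betw (\<lambda>\<rho>. (\<sigma> * inverse \<rho>, \<rho> * \<tau>)) (sym_group (X \<inter> Y)) (factorizations X Y \<pi>)"
  proof (rule bij_betw_byWitness[of _ "\<lambda>(\<sigma>', \<tau>'). \<tau>' * inverse \<tau>"])
    show "(\<lambda>\<rho>. (\<sigma> * inverse \<rho>, \<rho> * \<tau>)) ` sym_group (X \<inter> Y) \<subseteq> factorizations X Y \<pi>"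
      using \<sigma>\<tau> by (auto simp: factorizations_def sym_group_Int[symmetric] sym_group_mult
          sym_group_inverse mult.assoc)
    \<comment> \<open>Two expressions for the same \<open>\<rho>\<close>: one shows that it lies in
      \<open>sym_group Y\<close>, the other that it lies in \<open>sym_group X\<close>.\<close>
    have *: "\<tau>' * inverse \<tau> = inverse \<sigma>' * \<sigma>" if "\<sigma>' * \<tau>' = \<pi>" for \<sigma>' \<tau>'
    proof -
      have "\<tau>' = inverse \<sigma>' * \<pi>" using that by auto
      then show ?thesis by (simp add: \<sigma>\<tau>(3)[symmetric] mult.assoc)
    qed
    show "(\<lambda>(\<sigma>', \<tau>'). \<tau>' * inverse \<tau>) ` factorizations X Y \<pi> \<subseteq> sym_group (X \<inter> Y)"
    proof safe
      fix \<sigma>' \<tau>' assume "(\<sigma>', \<tau>') \<in> factorizations X Y \<pi>"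
      then have "\<sigma>' \<in> sym_group X" "\<tau>' \<in> sym_group Y" "\<sigma>' * \<tau>' = \<pi>"
        by (auto simp: factorizations_def)
      then have "\<tau>' * inverse \<tau> \<in> sym_group Y" "\<tau>' * inverse \<tau> \<in> sym_group X"
        using \<sigma>\<tau>(1,2) by (simp add: sym_group_mult sym_group_inverse, simp add: * sym_group_mult sym_group_inverse)
      then show "\<tau>' * inverse \<tau> \<in> sym_group (X \<inter> Y)"
        by (simp add: sym_group_Int[symmetric])
    qed
    show "\<forall>st\<in>factorizations X Y \<pi>. (\<sigma> * inverse (case st of (\<sigma>', \<tau>') \<Rightarrow> \<tau>' * inverse \<tau>),
        (case st of (\<sigma>', \<tau>') \<Rightarrow> \<tau>' * inverse \<tau>) * \<tau>) = st"
    proof safe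
      fix \<sigma>' \<tau>' assume "(\<sigma>', \<tau>') \<in> factorizations X Y \<pi>"
      then have "\<sigma>' * \<tau>' = \<sigma> * \<tau>" using \<sigma>\<tau>(3) by (simp add: factorizations_def)
      then have "\<sigma>' * (\<tau>' * inverse \<tau>) = \<sigma>"
        by (metis mult.assoc perm_mult_inverse_cancel(4))
      then show "\<sigma> * inverse (\<tau>' * inverse \<tau>) = \<sigma>'"
        by (metis perm_mult_inverse_cancel(4))
    qed simp
  qed (auto simp: mult.assoc)
  then show ?thesis
    using card_sym_group[of "X \<inter> Y"] assms(1) by (simp add: bij_betw_same_card)
qed

text \<open>It suffices to find \<open>\<rho>\<close> in \<open>sym_group Y\<close> that agrees with
  the inverse of \<open>\<pi>\<close> on \<open>Y - X\<close>: then \<open>\<pi> * \<rho>\<close>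
  fixes everything outside \<open>X\<close>, and multiplying it by \<open>inverse \<rho>\<close>
  gives \<open>\<pi>\<close>.\<close>

lemma factorizations_nonempty:
  assumes fin: "finite X" "finite Y" and \<pi>: "\<pi> \<in> sym_group (X \<union> Y)"
    and avoid: "(\<langle>$\<rangle>) \<pi> ` (X - Y) \<inter> (Y - X) = {}"
  shows "factorizations X Y \<pi> \<noteq> {}"
proof -
  let ?p = "(\<langle>$\<rangle>) \<pi>" and ?q = "inv ((\<langle>$\<rangle>) \<pi>)"
  have perm: "?p permutes (X \<union> Y)" using \<pi> by (simp add: sym_group_iff_permutes)
  \<comment> \<open>The avoidance assumption enters here: a preimage outside \<open>Y\<close> would
    be a point of \<open>X - Y\<close> sent into \<open>Y - X\<close>.\<close>
  have q: "?q ` (Y - X) \<subseteq> Y"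
  proof
    fix j assume "j \<in> ?q ` (Y - X)"
    then obtain i where i: "i \<in> Y - X" "j = ?q i" by blast
    then have "j \<in> X \<union> Y" "?p j = i"
      using permutes_in_image[OF permutes_inv[OF perm]] by (auto simp: permutes_inverses[OF perm])
    then show "j \<in> Y" using i avoid by blast
  qed
  have inj: "inj_on ?q (Y - X)"
    using permutes_inj[OF permutes_inv[OF perm]] by (rule inj_on_subset) simp
  have "card (X \<inter> Y) = card (Y - ?q ` (Y - X))"
  proof -
    have "card (Y - ?q ` (Y - X)) = card Y - card (Y - X)"
      using q fin by (simp add: card_Diff_subset card_image[OF inj] finite_subset)
    also have "\<dots> = card (X \<inter> Y)"
      using fin card_Int_Diff[of Y X] by (simp add: Int_commute)
    finally show ?thesis by simp
  qed
  \<comment> \<open>On \<open>X \<inter> Y\<close> any bijection onto the part of \<open>Y\<close>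
    still free will do.\<close>
  then obtain h where h: "bij_betw h (X \<inter> Y) (Y - ?q ` (Y - X))"
    using fin finite_same_card_bij by blast
  define g where "g i = (if i \<in> Y - X then ?q i else if i \<in> X \<inter> Y then h i else i)" for i
  have "bij_betw g (Y - X) (?q ` (Y - X))"
    by (rule bij_betw_cong[THEN iffD1, rotated, OF bij_betw_imageI[OF inj refl]]) (auto simp: g_def)
  moreover have "bij_betw g (X \<inter> Y) (Y - ?q ` (Y - X))"
    using h by (rule bij_betw_cong[THEN iffD1, rotated]) (auto simp: g_def)
  ultimately have "bij_betw g ((Y - X) \<union> (X \<inter> Y)) (?q ` (Y - X) \<union> (Y - ?q ` (Y - X)))"
    by (rule bij_betw_combine) auto
  moreover have "(Y - X) \<union> (X \<inter> Y) = Y" "?q ` (Y - X) \<union> (Y - ?q ` (Y - X)) = Y"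
    using q by auto
  ultimately have "bij_betw g Y Y" by simp
  then have "g permutes Y" by (rule bij_imp_permutes) (auto simp: g_def)
  then obtain \<rho> where \<rho>: "\<rho> \<in> sym_group Y" "(\<langle>$\<rangle>) \<rho> = g"
    using perm_of_permutes fin(2) by metis
  have "\<pi> * \<rho> \<in> sym_group X"
    using \<pi> by (auto simp: sym_group_def apply_times \<rho>(2) g_def permutes_inverses[OF perm])
  then have "(\<pi> * \<rho>, inverse \<rho>) \<in> factorizations X Y \<pi>"
    using \<rho>(1) by (simp add: factorizations_def sym_group_inverse)
  then show ?thesis by blast
qed

text \<open>The avoidance condition is also necessary: \<open>\<tau>\<close> fixes
  \<open>X - Y\<close>, so \<open>\<pi>\<close> acts there as \<open>\<sigma>\<close> and stays in
  \<open>X\<close>.\<close>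

lemma card_factorizations:
  assumes "finite X" "finite Y"
  shows "card (factorizations X Y \<pi>) =
    (if \<pi> \<in> sym_group (X \<union> Y) \<and> (\<langle>$\<rangle>) \<pi> ` (X - Y) \<inter> (Y - X) = {} then fact (card (X \<inter> Y)) else 0)"
proof (cases "factorizations X Y \<pi> = {}")
  case True
  then show ?thesis using factorizations_nonempty[OF assms] by auto
next
  case False
  then obtain \<sigma> \<tau> where st: "(\<sigma>, \<tau>) \<in> factorizations X Y \<pi>" by auto
  then have "\<sigma> \<in> sym_group (X \<union> Y)" "\<tau> \<in> sym_group (X \<union> Y)"
    using sym_group_mono[of X "X \<union> Y"] sym_group_mono[of Y "X \<union> Y"] by (auto simp: factorizations_def)
  then have "\<pi> \<in> sym_group (X \<union> Y)"
    using st sym_group_mult by (auto simp: factorizations_def)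
  moreover have "\<pi> \<langle>$\<rangle> i \<notin> Y - X" if "i \<in> X - Y" for i
  proof -
    have "\<pi> \<langle>$\<rangle> i = \<sigma> \<langle>$\<rangle> i" "\<sigma> \<langle>$\<rangle> i \<in> X"
      using st that permutes_in_image[of "(\<langle>$\<rangle>) \<sigma>" X i]
      by (auto simp: factorizations_def apply_times sym_group_iff_permutes permutes_not_in)
    then show ?thesis by auto
  qed
  ultimately show ?thesis using card_factorizations_eq_fact[OF assms st] by auto
qed

text \<open>In the criterion of \<open>card_factorizations\<close>, exchanging \<open>X\<close> and
  \<open>Y\<close> amounts to inverting \<open>\<pi>\<close>.\<close>

lemma card_factorizations_swap:
  assumes "finite X" "finite Y"
  shows "card (factorizations Y X \<pi>) = card (factorizations X Y (inverse \<pi>))"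
proof -
  have "(\<langle>$\<rangle>) \<pi> ` (Y - X) \<inter> (X - Y) = {} \<longleftrightarrow> (\<langle>$\<rangle>) (inverse \<pi>) ` (X - Y) \<inter> (Y - X) = {}"
    unfolding apply_inverse by (auto simp: bij_is_inj bij_is_surj surj_f_inv_f)
  then show ?thesis
    using assms by (simp add: card_factorizations sym_group_inverse_iff Un_commute Int_commute)
qed

section \<open>Symmetrizers with a sign, and commutation for equal signs\<close>

text \<open>The Boolean selects the sign: \<^const>\<open>True\<close> for \<open>\<alpha>\<^sup>+\<close>, \<open>\<beta>\<^sup>+\<close> and \<^const>\<open>False\<close> for \<open>\<alpha>\<^sup>-\<close>, \<open>\<beta>\<^sup>-\<close>.\<close>

definition chi :: "bool \<Rightarrow> nat perm \<Rightarrow> complex" where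
  "chi b \<sigma> = (if b then 1 else of_int (sign ((\<langle>$\<rangle>) \<sigma>)))"

lemma permutation_apply: "permutation ((\<langle>$\<rangle>) (\<sigma> :: nat perm))"
proof -
  have "(\<langle>$\<rangle>) \<sigma> permutes affected \<sigma>"
    by (simp add: in_affected flip: sym_group_iff_permutes) (simp add: sym_group_def in_affected)
  then show ?thesis using finite_affected permutation_permutes by blast
qed

lemma chi_mult: "chi b (\<sigma> * \<tau>) = chi b \<sigma> * chi b \<tau>"
  by (simp add: chi_def apply_times sign_compose permutation_apply)

lemma chi_swap: "i \<noteq> j \<Longrightarrow> chi b \<langle>i \<leftrightarrow> j\<rangle> = (if b then 1 else - 1)"
  by (simp add: chi_def swap.rep_eq sign_swap_id)

definition alpha :: "bool \<Rightarrow> nat set \<Rightarrow> nat perm \<Rightarrow>\<^sub>0 complex" where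
  "alpha b X = (\<Sum>\<sigma>\<in>sym_group X. Poly_Mapping.single \<sigma> (chi b \<sigma>))"

text \<open>As \<open>chi b\<close> is multiplicative, every factorization of \<open>\<pi>\<close>
  contributes the same value \<open>chi b \<pi>\<close>.\<close>

lemma lookup_alpha_mult:
  assumes "finite X" "finite Y"
  shows "Poly_Mapping.lookup (alpha b X * alpha b Y) \<pi> = chi b \<pi> * of_nat (card (factorizations X Y \<pi>))"
proof -
  have fin: "finite (sym_group X \<times> sym_group Y)"
    using assms by (simp add: finite_sym_group)
  have "alpha b X * alpha b Y =
      (\<Sum>(\<sigma>, \<tau>)\<in>sym_group X \<times> sym_group Y. Poly_Mapping.single (\<sigma> * \<tau>) (chi b (\<sigma> * \<tau>)))"
    by (simp add: alpha_def sum_product sum.cartesian_product single_perm_mult chi_mult)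
  then have "Poly_Mapping.lookup (alpha b X * alpha b Y) \<pi> =
      (\<Sum>p\<in>sym_group X \<times> sym_group Y. if p \<in> factorizations X Y \<pi> then chi b \<pi> else 0)"
    by (simp add: lookup_sum split_def)
      (intro sum.cong, auto simp: lookup_single factorizations_def when_def)
  also have "\<dots> = (\<Sum>p\<in>factorizations X Y \<pi>. chi b \<pi>)"
    by (rule sum.mono_neutral_cong_right[OF fin]) (auto simp: factorizations_def)
  finally show ?thesis by simp
qed

definition beta :: "bool \<Rightarrow> nat \<Rightarrow> (nat \<Rightarrow> complex) \<Rightarrow> nat \<Rightarrow> complex \<Rightarrow> nat perm \<Rightarrow>\<^sub>0 complex" where
  "beta b n z k u = (\<Sum>X | X \<subseteq> {1..n} \<and> card X = k. scale (\<Prod>i\<in>{1..n} - X. u + z i) (alpha b X))"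

lemma beta_mult:
  "beta b n z k u * beta c n z l v =
     (\<Sum>X | X \<subseteq> {1..n} \<and> card X = k. \<Sum>Y | Y \<subseteq> {1..n} \<and> card Y = l.
        scale ((\<Prod>i\<in>{1..n} - X. u + z i) * (\<Prod>i\<in>{1..n} - Y. v + z i)) (alpha b X * alpha c Y))"
  by (simp add: beta_def sum_product scale_mult_left scale_mult_right mult.commute)

text \<open>Pairs are grouped by \<open>D = X \<union> Y\<close> and recovered as
  \<open>X = D - P\<close>, \<open>Y = D - S\<close>. The complement of \<open>X\<close> in
  \<open>N\<close> is then the disjoint union of \<open>N - D\<close> and \<open>P\<close>, that of
  \<open>Y\<close> the disjoint union of \<open>N - D\<close> and \<open>S\<close>, and
  \<open>X \<inter> Y\<close> has \<open>k + l - card D\<close> elements.\<close>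

lemma sum_factorizations_eq_sum_avoiding:
  fixes f g :: "nat \<Rightarrow> complex"
  assumes "finite N"
  shows "(\<Sum>X | X \<subseteq> N \<and> card X = k. \<Sum>Y | Y \<subseteq> N \<and> card Y = l.
      (\<Prod>i\<in>N - X. f i) * (\<Prod>i\<in>N - Y. g i) * of_nat (card (factorizations X Y \<pi>))) =
    (\<Sum>D | D \<subseteq> N \<and> \<pi> \<in> sym_group D \<and> k \<le> card D \<and> l \<le> card D.
      (\<Prod>i\<in>N - D. f i * g i) * fact (k + l - card D) *
      avoiding_sum D f g ((\<langle>$\<rangle>) \<pi>) (card D - k) (card D - l))"
proof -
  let ?p = "(\<langle>$\<rangle>) \<pi>"
  define w where "w X Y = (\<Prod>i\<in>N - X. f i) * (\<Prod>i\<in>N - Y. g i) * fact (card (X \<inter> Y))" for X Y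
  define A where "A = {(X, Y). X \<subseteq> N \<and> card X = k \<and> Y \<subseteq> N \<and> card Y = l \<and>
      \<pi> \<in> sym_group (X \<union> Y) \<and> ?p ` (X - Y) \<inter> (Y - X) = {}}"
  define B where "B = (SIGMA D:{D. D \<subseteq> N \<and> \<pi> \<in> sym_group D \<and> k \<le> card D \<and> l \<le> card D}.
      SIGMA S:{S. S \<subseteq> D \<and> card S = card D - l}. {P. P \<subseteq> D - (S \<union> ?p ` S) \<and> card P = card D - k})"
  have fin: "finite X" if "X \<subseteq> N" for X using assms that finite_subset by blast
  have fin': "finite {X. X \<subseteq> M \<and> Q X}" if "M \<subseteq> N" for M Q
    by (rule finite_subset[of _ "Pow N"]) (use assms that in auto)
  have "(\<Sum>X | X \<subseteq> N \<and> card X = k. \<Sum>Y | Y \<subseteq> N \<and> card Y = l.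
      (\<Prod>i\<in>N - X. f i) * (\<Prod>i\<in>N - Y. g i) * of_nat (card (factorizations X Y \<pi>))) =
    (\<Sum>(X, Y)\<in>{X. X \<subseteq> N \<and> card X = k} \<times> {Y. Y \<subseteq> N \<and> card Y = l}.
      (\<Prod>i\<in>N - X. f i) * (\<Prod>i\<in>N - Y. g i) * of_nat (card (factorizations X Y \<pi>)))"
    by (rule sum.cartesian_product)
  also have "\<dots> = (\<Sum>(X, Y)\<in>A. w X Y)"
    by (rule sum.mono_neutral_cong_right)
      (auto simp: A_def w_def fin fin' card_factorizations split: if_splits, blast)
  also have "\<dots> = (\<Sum>(D, S, P)\<in>B. w (D - P) (D - S))"
  proof (rule sum.reindex_bij_witness[of _ "\<lambda>(D, S, P). (D - P, D - S)" "\<lambda>(X, Y). (X \<union> Y, X - Y, Y - X)"])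
    fix st assume "st \<in> A"
    then obtain X Y where st: "st = (X, Y)" "X \<subseteq> N" "card X = k" "Y \<subseteq> N" "card Y = l"
      "\<pi> \<in> sym_group (X \<union> Y)" "?p ` (X - Y) \<inter> (Y - X) = {}"
      by (auto simp: A_def)
    have *: "X \<union> Y - (Y - X) = X" "X \<union> Y - (X - Y) = Y" by auto
    show "(case case st of (X, Y) \<Rightarrow> (X \<union> Y, X - Y, Y - X) of (D, S, P) \<Rightarrow> (D - P, D - S)) = st"
      by (simp only: st * prod.case)
    show "(case case st of (X, Y) \<Rightarrow> (X \<union> Y, X - Y, Y - X) of (D, S, P) \<Rightarrow> w (D - P) (D - S)) =
        (case st of (X, Y) \<Rightarrow> w X Y)"
      by (simp only: st * prod.case)
    have "card X \<le> card (X \<union> Y)" "card Y \<le> card (X \<union> Y)"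
      using st fin by (auto intro!: card_mono)
    moreover have "card (X - Y) = card (X \<union> Y) - card Y" "card (Y - X) = card (X \<union> Y) - card X"
      using st fin card_Diff_subset[of Y "X \<union> Y"] card_Diff_subset[of X "X \<union> Y"]
      by (simp_all add: Un_Diff)
    ultimately show "(case st of (X, Y) \<Rightarrow> (X \<union> Y, X - Y, Y - X)) \<in> B"
      using st by (auto simp: B_def)
  next
    fix d assume "d \<in> B"
    then obtain D S P where d: "d = (D, S, P)" "D \<subseteq> N" "\<pi> \<in> sym_group D" "k \<le> card D" "l \<le> card D"
      "S \<subseteq> D" "card S = card D - l" "P \<subseteq> D - (S \<union> ?p ` S)" "card P = card D - k"
      by (auto simp: B_def)
    have *: "(D - P) \<union> (D - S) = D" "(D - P) - (D - S) = S" "(D - S) - (D - P) = P" using d by auto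
    show "(case case d of (D, S, P) \<Rightarrow> (D - P, D - S) of (X, Y) \<Rightarrow> (X \<union> Y, X - Y, Y - X)) = d"
      by (simp only: d * prod.case)
    have "P \<subseteq> D" using d by auto
    then have "finite P" "finite S" "P \<subseteq> D" using d fin[of P] fin[of S] by auto
    then have "card (D - P) = k" "card (D - S) = l"
      using d by (simp_all add: card_Diff_subset)
    moreover have "?p ` S \<inter> P = {}" using d by auto
    ultimately show "(case d of (D, S, P) \<Rightarrow> (D - P, D - S)) \<in> A"
      using d(2,3) by (auto simp: A_def d(1) * simp del: Diff_Diff_Int)
  qed
  also have "\<dots> = (\<Sum>D | D \<subseteq> N \<and> \<pi> \<in> sym_group D \<and> k \<le> card D \<and> l \<le> card D.
      \<Sum>S | S \<subseteq> D \<and> card S = card D - l. \<Sum>P | P \<subseteq> D - (S \<union> ?p ` S) \<and> card P = card D - k. w (D - P) (D - S))"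
    unfolding B_def
    by (subst sum.Sigma[symmetric]; (intro ballI fin' finite_SigmaI; auto)?)
      (intro sum.cong refl, subst sum.Sigma, auto intro!: fin')
  also have "\<dots> = (\<Sum>D | D \<subseteq> N \<and> \<pi> \<in> sym_group D \<and> k \<le> card D \<and> l \<le> card D.
      (\<Prod>i\<in>N - D. f i * g i) * fact (k + l - card D) *
      avoiding_sum D f g ?p (card D - k) (card D - l))"
    unfolding avoiding_sum_def sum_distrib_left
  proof (intro sum.cong refl)
    fix D S P
    assume "D \<in> {D. D \<subseteq> N \<and> \<pi> \<in> sym_group D \<and> k \<le> card D \<and> l \<le> card D}"
      "S \<in> {S. S \<subseteq> D \<and> card S = card D - l}" "P \<in> {P. P \<subseteq> D - (S \<union> ?p ` S) \<and> card P = card D - k}"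
    then have D: "D \<subseteq> N" "k \<le> card D" "l \<le> card D" and S: "S \<subseteq> D" "card S = card D - l"
      and P: "P \<subseteq> D" "P \<inter> S = {}" "card P = card D - k"
      by auto
    have prod: "(\<Prod>i\<in>N - (D - T). h i) = (\<Prod>i\<in>N - D. h i) * (\<Prod>i\<in>T. h i)"
      if "T \<subseteq> D" for T and h :: "nat \<Rightarrow> complex"
    proof -
      have "N - (D - T) = (N - D) \<union> T" using that D by auto
      then show ?thesis using that D fin[of T] assms by (simp add: prod.union_disjoint Int_commute disjoint_iff subset_iff)
    qed
    have "(D - P) \<inter> (D - S) = D - (P \<union> S)" by auto
    then have "card ((D - P) \<inter> (D - S)) = card D - (card P + card S)"
      using D S P finite_subset[OF P(1)] finite_subset[OF S(1)] fin[of D]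
      by (simp add: card_Diff_subset card_Un_disjoint)
    also have "\<dots> = k + l - card D" using S P D by simp
    finally show "w (D - P) (D - S) = (\<Prod>i\<in>N - D. f i * g i) * fact (k + l - card D) *
        ((\<Prod>i\<in>P. f i) * (\<Prod>i\<in>S. g i))"
      using S P by (simp add: w_def prod prod.distrib mult_ac)
  qed
  finally show ?thesis .
qed

text \<open>Up to the common factor \<open>chi b \<pi>\<close>, the coefficients of
  \<open>\<pi>\<close> in the two products are one expression \<open>F\<close> taken at
  \<open>\<pi>\<close> and at its inverse. They agree by \<open>avoiding_sum_inv\<close>, as
  \<open>u + z i\<close> and \<open>v + z i\<close> differ by \<open>u - v\<close> for all
  \<open>i\<close>.\<close>

lemma beta_commute: "beta b n z k u * beta b n z l v = beta b n z l v * beta b n z k u"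
proof (rule poly_mapping_eqI)
  fix \<pi>
  let ?N = "{1..n}"
  define F where "F \<pi> = (\<Sum>X | X \<subseteq> ?N \<and> card X = k. \<Sum>Y | Y \<subseteq> ?N \<and> card Y = l.
     (\<Prod>i\<in>?N - X. u + z i) * (\<Prod>i\<in>?N - Y. v + z i) * of_nat (card (factorizations X Y \<pi>)))" for \<pi>
  have fin: "finite X" if "X \<subseteq> ?N" for X using that finite_subset by blast
  have "F (inverse \<pi>) = F \<pi>"
    unfolding F_def sum_factorizations_eq_sum_avoiding[OF finite_atLeastAtMost]
  proof (rule sum.cong)
    fix D assume "D \<in> {D. D \<subseteq> ?N \<and> \<pi> \<in> sym_group D \<and> k \<le> card D \<and> l \<le> card D}"
    then have "finite D" "(\<langle>$\<rangle>) \<pi> permutes D"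
      using fin by (auto simp: sym_group_iff_permutes)
    from avoiding_sum_inv[OF this, of "\<lambda>i. u + z i" "\<lambda>i. v + z i" "u - v"]
    show "(\<Prod>i\<in>?N - D. (u + z i) * (v + z i)) * fact (k + l - card D) *
        avoiding_sum D (\<lambda>i. u + z i) (\<lambda>i. v + z i) ((\<langle>$\<rangle>) (inverse \<pi>)) (card D - k) (card D - l) =
      (\<Prod>i\<in>?N - D. (u + z i) * (v + z i)) * fact (k + l - card D) *
        avoiding_sum D (\<lambda>i. u + z i) (\<lambda>i. v + z i) ((\<langle>$\<rangle>) \<pi>) (card D - k) (card D - l)"
      by (simp add: apply_inverse)
  qed (simp add: sym_group_inverse_iff)
  moreover have "Poly_Mapping.lookup (beta b n z k u * beta b n z l v) \<pi> = chi b \<pi> * F \<pi>"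
    by (simp add: beta_mult lookup_sum lookup_scale lookup_alpha_mult fin F_def sum_distrib_left mult_ac)
  moreover have "Poly_Mapping.lookup (beta b n z l v * beta b n z k u) \<pi> = chi b \<pi> * F (inverse \<pi>)"
    unfolding beta_mult
    by (subst sum.swap)
      (simp add: lookup_sum lookup_scale lookup_alpha_mult fin F_def sum_distrib_left mult_ac
        card_factorizations_swap[of _ _ \<pi>])
  ultimately show "Poly_Mapping.lookup (beta b n z k u * beta b n z l v) \<pi> =
      Poly_Mapping.lookup (beta b n z l v * beta b n z k u) \<pi>"
    by simp
qed

section \<open>Products of opposite signs\<close>

lemma chi_one [simp]: "chi b 1 = 1"
  by (simp add: chi_def)

lemma inverse_apply_eq_iff: "inverse \<rho> \<langle>$\<rangle> i = j \<longleftrightarrow> \<rho> \<langle>$\<rangle> j = i"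
  by (auto simp: apply_inverse bij_is_inj bij_is_surj surj_f_inv_f)

lemma swap_in_sym_group: "x \<in> X \<Longrightarrow> y \<in> X \<Longrightarrow> \<langle>x \<leftrightarrow> y\<rangle> \<in> sym_group X"
  by (auto simp: sym_group_def intro!: apply_swap_same)

text \<open>Decomposition into cosets of \<open>sym_group W\<close>: the coset of
  \<open>\<rho>\<close> is determined by the point \<open>x\<close> that \<open>\<rho>\<close> sends
  to \<open>j\<close>, the case \<open>x = j\<close> giving \<open>sym_group W\<close>
  itself.\<close>

lemma sum_sym_group_insert_right:
  assumes "finite W" "j \<notin> W"
  shows "(\<Sum>\<rho>\<in>sym_group (insert j W). F \<rho>) =
    (\<Sum>x\<in>insert j W. \<Sum>\<sigma>\<in>sym_group W. F (\<sigma> * \<langle>x \<leftrightarrow> j\<rangle>))"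
proof -
  have "(\<Sum>\<rho>\<in>sym_group (insert j W). F \<rho>) =
      (\<Sum>(x, \<sigma>)\<in>insert j W \<times> sym_group W. F (\<sigma> * \<langle>x \<leftrightarrow> j\<rangle>))"
  proof (rule sum.reindex_bij_witness[of _ "\<lambda>(x, \<sigma>). \<sigma> * \<langle>x \<leftrightarrow> j\<rangle>"
        "\<lambda>\<rho>. (inverse \<rho> \<langle>$\<rangle> j, \<rho> * \<langle>inverse \<rho> \<langle>$\<rangle> j \<leftrightarrow> j\<rangle>)"])
    fix \<rho> assume \<rho>: "\<rho> \<in> sym_group (insert j W)"
    define x where "x = inverse \<rho> \<langle>$\<rangle> j"
    have x: "\<rho> \<langle>$\<rangle> x = j" unfolding x_def by (subst inverse_apply_eq_iff[symmetric]) simp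
    have "x \<in> insert j W"
      using \<rho> x by (auto simp: sym_group_def)
    moreover have "\<rho> * \<langle>x \<leftrightarrow> j\<rangle> \<in> sym_group W"
      unfolding sym_group_def
    proof safe
      fix i assume "i \<notin> W"
      show "(\<rho> * \<langle>x \<leftrightarrow> j\<rangle>) \<langle>$\<rangle> i = i"
      proof (cases "i = j")
        case False
        then have "i \<noteq> x" using \<open>i \<notin> W\<close> \<open>x \<in> insert j W\<close> by auto
        then have "\<langle>x \<leftrightarrow> j\<rangle> \<langle>$\<rangle> i = i" using False by simp
        then show ?thesis using \<rho> False \<open>i \<notin> W\<close> by (simp add: sym_group_def apply_times)
      qed (simp add: x apply_times)
    qed
    ultimately show "(inverse \<rho> \<langle>$\<rangle> j, \<rho> * \<langle>inverse \<rho> \<langle>$\<rangle> j \<leftrightarrow> j\<rangle>) \<in> insert j W \<times> sym_group W"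
      by (simp add: x_def)
    show "(case (inverse \<rho> \<langle>$\<rangle> j, \<rho> * \<langle>inverse \<rho> \<langle>$\<rangle> j \<leftrightarrow> j\<rangle>) of (x, \<sigma>) \<Rightarrow> \<sigma> * \<langle>x \<leftrightarrow> j\<rangle>) = \<rho>"
      by (simp add: mult.assoc)
    then show "(case (inverse \<rho> \<langle>$\<rangle> j, \<rho> * \<langle>inverse \<rho> \<langle>$\<rangle> j \<leftrightarrow> j\<rangle>) of (x, \<sigma>) \<Rightarrow> F (\<sigma> * \<langle>x \<leftrightarrow> j\<rangle>)) = F \<rho>"
      by simp
  next
    fix p assume "p \<in> insert j W \<times> sym_group W"
    then obtain x \<sigma> where p: "p = (x, \<sigma>)" "x \<in> insert j W" "\<sigma> \<in> sym_group W" by auto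
    have "(\<sigma> * \<langle>x \<leftrightarrow> j\<rangle>) \<langle>$\<rangle> x = j"
      using p(3) assms(2) by (simp add: apply_times sym_group_def)
    then have x: "inverse (\<sigma> * \<langle>x \<leftrightarrow> j\<rangle>) \<langle>$\<rangle> j = x" by (simp only: inverse_apply_eq_iff)
    show "(inverse (case p of (x, \<sigma>) \<Rightarrow> \<sigma> * \<langle>x \<leftrightarrow> j\<rangle>) \<langle>$\<rangle> j, (case p of (x, \<sigma>) \<Rightarrow> \<sigma> * \<langle>x \<leftrightarrow> j\<rangle>) *
        \<langle>inverse (case p of (x, \<sigma>) \<Rightarrow> \<sigma> * \<langle>x \<leftrightarrow> j\<rangle>) \<langle>$\<rangle> j \<leftrightarrow> j\<rangle>) = p"
      by (simp only: p(1) prod.case x) (simp add: mult.assoc)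
    have "\<langle>x \<leftrightarrow> j\<rangle> \<in> sym_group (insert j W)"
      using p(2) by (simp add: swap_in_sym_group)
    then show "(case p of (x, \<sigma>) \<Rightarrow> \<sigma> * \<langle>x \<leftrightarrow> j\<rangle>) \<in> sym_group (insert j W)"
      using p(1,3) sym_group_mono[of W "insert j W"] by (auto intro: sym_group_mult)
  qed
  then show ?thesis by (simp add: sum.cartesian_product)
qed

lemma sum_sym_group_inverse: "(\<Sum>\<rho>\<in>sym_group X. F (inverse \<rho>)) = (\<Sum>\<rho>\<in>sym_group X. F \<rho>)"
  by (rule sum.reindex_bij_witness[of _ inverse inverse])
    (auto simp: sym_group_inverse perm_eq_iff apply_inverse inv_inv_eq)

text \<open>Inversion turns right cosets into left cosets.\<close>

lemma sum_sym_group_insert_left: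
  assumes "finite W" "j \<notin> W"
  shows "(\<Sum>\<rho>\<in>sym_group (insert j W). F \<rho>) =
    (\<Sum>x\<in>insert j W. \<Sum>\<sigma>\<in>sym_group W. F (\<langle>x \<leftrightarrow> j\<rangle> * \<sigma>))"
proof -
  have "(\<Sum>\<rho>\<in>sym_group (insert j W). F \<rho>) = (\<Sum>\<rho>\<in>sym_group (insert j W). F (inverse \<rho>))"
    by (simp add: sum_sym_group_inverse)
  also have "\<dots> = (\<Sum>x\<in>insert j W. \<Sum>\<sigma>\<in>sym_group W. F (\<langle>x \<leftrightarrow> j\<rangle> * inverse \<sigma>))"
    by (simp only: sum_sym_group_insert_right[OF assms] perm.inverse_distrib_swap inverse_swap)
  also have "\<dots> = (\<Sum>x\<in>insert j W. \<Sum>\<sigma>\<in>sym_group W. F (\<langle>x \<leftrightarrow> j\<rangle> * \<sigma>))"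
    by (intro sum.cong refl sum_sym_group_inverse[of "\<lambda>\<sigma>. F (_ * \<sigma>)"])
  finally show ?thesis .
qed

text \<open>The value of \<open>chi b\<close> on a transposition.\<close>

definition eps :: "bool \<Rightarrow> complex" where
  "eps b = (if b then 1 else - 1)"

lemma eps_not: "eps (\<not> b) = - eps b"
  by (simp add: eps_def)

abbreviation transp :: "nat \<Rightarrow> nat \<Rightarrow> nat perm \<Rightarrow>\<^sub>0 complex" where
  "transp i j \<equiv> Poly_Mapping.single \<langle>i \<leftrightarrow> j\<rangle> 1"

text \<open>In the sum over cosets, the one with \<open>x = j\<close> gives
  \<open>alpha b W\<close>, and every other one picks up the sign of a transposition.\<close>

lemma alpha_insert_right:
  assumes "finite W" "j \<notin> W"
  shows "alpha b (insert j W) = alpha b W + scale (eps b) (\<Sum>x\<in>W. alpha b W * transp x j)"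
proof -
  have "alpha b (insert j W) = alpha b W +
      (\<Sum>x\<in>W. \<Sum>\<sigma>\<in>sym_group W. Poly_Mapping.single (\<sigma> * \<langle>x \<leftrightarrow> j\<rangle>) (chi b (\<sigma> * \<langle>x \<leftrightarrow> j\<rangle>)))"
    using assms by (simp add: alpha_def sum_sym_group_insert_right)
  also have "(\<Sum>x\<in>W. \<Sum>\<sigma>\<in>sym_group W. Poly_Mapping.single (\<sigma> * \<langle>x \<leftrightarrow> j\<rangle>) (chi b (\<sigma> * \<langle>x \<leftrightarrow> j\<rangle>))) =
      (\<Sum>x\<in>W. scale (eps b) (alpha b W * transp x j))"
  proof (intro sum.cong refl)
    fix x assume "x \<in> W"
    with assms have "x \<noteq> j" by auto
    then show "(\<Sum>\<sigma>\<in>sym_group W. Poly_Mapping.single (\<sigma> * \<langle>x \<leftrightarrow> j\<rangle>) (chi b (\<sigma> * \<langle>x \<leftrightarrow> j\<rangle>))) =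
        scale (eps b) (alpha b W * transp x j)"
      by (simp add: alpha_def sum_distrib_right group_algebra.scale_sum_right single_perm_mult
          scale_single chi_mult chi_swap eps_def)
  qed
  finally show ?thesis by (simp add: group_algebra.scale_sum_right)
qed

lemma alpha_insert_left:
  assumes "finite W" "j \<notin> W"
  shows "alpha b (insert j W) = alpha b W + scale (eps b) (\<Sum>x\<in>W. transp x j * alpha b W)"
proof -
  have "alpha b (insert j W) = alpha b W +
      (\<Sum>x\<in>W. \<Sum>\<sigma>\<in>sym_group W. Poly_Mapping.single (\<langle>x \<leftrightarrow> j\<rangle> * \<sigma>) (chi b (\<langle>x \<leftrightarrow> j\<rangle> * \<sigma>)))"
    using assms by (simp add: alpha_def sum_sym_group_insert_left)
  also have "(\<Sum>x\<in>W. \<Sum>\<sigma>\<in>sym_group W. Poly_Mapping.single (\<langle>x \<leftrightarrow> j\<rangle> * \<sigma>) (chi b (\<langle>x \<leftrightarrow> j\<rangle> * \<sigma>))) =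
      (\<Sum>x\<in>W. scale (eps b) (transp x j * alpha b W))"
  proof (intro sum.cong refl)
    fix x assume "x \<in> W"
    with assms have "x \<noteq> j" by auto
    then show "(\<Sum>\<sigma>\<in>sym_group W. Poly_Mapping.single (\<langle>x \<leftrightarrow> j\<rangle> * \<sigma>) (chi b (\<langle>x \<leftrightarrow> j\<rangle> * \<sigma>))) =
        scale (eps b) (transp x j * alpha b W)"
      by (simp add: alpha_def sum_distrib_left group_algebra.scale_sum_right single_perm_mult
          scale_single chi_mult chi_swap eps_def)
  qed
  finally show ?thesis by (simp add: group_algebra.scale_sum_right)
qed

text \<open>
  Since \<open>b\<close> and \<open>\<not> b\<close> have opposite signs on transpositions, all terms with a transposition between
  \<open>W\<close> and \<open>V\<close> cancel.
\<close>

lemma alpha_mult_alpha_disjoint: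
  assumes "finite W" "finite V" "W \<inter> V = {}"
  shows "scale (of_nat (card W + card V)) (alpha b W * alpha (\<not> b) V) =
    (\<Sum>j\<in>V. alpha b (insert j W) * alpha (\<not> b) V) + (\<Sum>j\<in>W. alpha b W * alpha (\<not> b) (insert j V))"
proof -
  let ?a = "alpha b W" and ?c = "alpha (\<not> b) V"
  have const: "(\<Sum>j\<in>S. ?a * ?c) = scale (of_nat (card S)) (?a * ?c)" for S :: "nat set"
    by (rule group_algebra.sum_constant_scale)
  have "(\<Sum>j\<in>V. alpha b (insert j W) * ?c) =
      (\<Sum>j\<in>V. ?a * ?c + scale (eps b) (\<Sum>x\<in>W. ?a * transp x j * ?c))"
    using assms by (intro sum.cong refl)
      (subst alpha_insert_right, auto simp: distrib_right scale_mult_left sum_distrib_right)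
  also have "\<dots> = scale (of_nat (card V)) (?a * ?c) +
      scale (eps b) (\<Sum>j\<in>V. \<Sum>x\<in>W. ?a * transp x j * ?c)"
    by (simp add: sum.distrib const group_algebra.scale_sum_right del: sum_constant)
  finally have 1: "(\<Sum>j\<in>V. alpha b (insert j W) * ?c) = \<dots>" .
  have "(\<Sum>j\<in>W. ?a * alpha (\<not> b) (insert j V)) =
      (\<Sum>j\<in>W. ?a * ?c + scale (eps (\<not> b)) (\<Sum>x\<in>V. ?a * transp j x * ?c))"
    using assms by (intro sum.cong refl)
      (subst alpha_insert_left, auto simp: distrib_left scale_mult_right sum_distrib_left mult.assoc swap_sym)
  also have "\<dots> = scale (of_nat (card W)) (?a * ?c) -
      scale (eps b) (\<Sum>j\<in>W. \<Sum>x\<in>V. ?a * transp j x * ?c)"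
    by (simp add: sum.distrib const group_algebra.scale_sum_right eps_not sum_subtractf sum_negf del: sum_constant)
  also have "(\<Sum>j\<in>W. \<Sum>x\<in>V. ?a * transp j x * ?c) = (\<Sum>j\<in>V. \<Sum>x\<in>W. ?a * transp x j * ?c)"
    by (rule sum.swap)
  finally show ?thesis
    by (simp add: 1 group_algebra.scale_left_distrib)
qed

lemma alpha_mult_transp:
  assumes "x \<in> X" "y \<in> X" "x \<noteq> y"
  shows "alpha b X * transp x y = scale (eps b) (alpha b X)"
    and "transp x y * alpha b X = scale (eps b) (alpha b X)"
proof -
  have s: "\<langle>x \<leftrightarrow> y\<rangle> \<in> sym_group X"
    using assms by (simp add: swap_in_sym_group)
  have "(\<Sum>\<sigma>\<in>sym_group X. Poly_Mapping.single (\<sigma> * \<langle>x \<leftrightarrow> y\<rangle>) (chi b \<sigma>)) =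
      (\<Sum>\<sigma>\<in>sym_group X. Poly_Mapping.single \<sigma> (eps b * chi b \<sigma>))"
    by (rule sum.reindex_bij_witness[of _ "\<lambda>\<sigma>. \<sigma> * \<langle>x \<leftrightarrow> y\<rangle>" "\<lambda>\<sigma>. \<sigma> * \<langle>x \<leftrightarrow> y\<rangle>"])
      (use s assms(3) in \<open>auto simp: sym_group_mult mult.assoc chi_mult chi_swap eps_def\<close>)
  then show "alpha b X * transp x y = scale (eps b) (alpha b X)"
    by (simp add: alpha_def sum_distrib_right group_algebra.scale_sum_right single_perm_mult scale_single)
  have "(\<Sum>\<sigma>\<in>sym_group X. Poly_Mapping.single (\<langle>x \<leftrightarrow> y\<rangle> * \<sigma>) (chi b \<sigma>)) =
      (\<Sum>\<sigma>\<in>sym_group X. Poly_Mapping.single \<sigma> (eps b * chi b \<sigma>))"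
    by (rule sum.reindex_bij_witness[of _ "\<lambda>\<sigma>. \<langle>x \<leftrightarrow> y\<rangle> * \<sigma>" "\<lambda>\<sigma>. \<langle>x \<leftrightarrow> y\<rangle> * \<sigma>"])
      (use s assms(3) in \<open>auto simp: sym_group_mult chi_mult chi_swap eps_def simp flip: mult.assoc\<close>)
  then show "transp x y * alpha b X = scale (eps b) (alpha b X)"
    by (simp add: alpha_def sum_distrib_left group_algebra.scale_sum_right single_perm_mult scale_single)
qed

text \<open>The transposition of \<open>x\<close> and \<open>y\<close> can be absorbed by either
  factor, with opposite signs.\<close>

lemma alpha_mult_alpha_eq_0:
  assumes "x \<in> X \<inter> Y" "y \<in> X \<inter> Y" "x \<noteq> y"
  shows "alpha b X * alpha (\<not> b) Y = 0"
proof -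
  have "scale (eps b) (alpha b X * alpha (\<not> b) Y) = alpha b X * transp x y * alpha (\<not> b) Y"
    using assms by (simp add: alpha_mult_transp scale_mult_left)
  also have "\<dots> = scale (eps (\<not> b)) (alpha b X * alpha (\<not> b) Y)"
    using assms by (simp add: alpha_mult_transp(2)[of x Y y] scale_mult_right mult.assoc)
  finally have "eps b = eps (\<not> b) \<or> alpha b X * alpha (\<not> b) Y = 0"
    by (simp only: group_algebra.scale_cancel_right)
  then show ?thesis by (auto simp: eps_def split: if_splits)
qed

section \<open>Alternating sums of products of opposite signs\<close>

context
  fixes n :: nat and z :: "nat \<Rightarrow> complex" and b :: bool
begin

text \<open>The coefficient of \<open>alpha b X * alpha (\<not> b) Y\<close> in the alternating sum
  of \<open>alternating_beta_sum\<close>.\<close>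

definition overlap_weight :: "complex \<Rightarrow> complex \<Rightarrow> nat set \<Rightarrow> nat set \<Rightarrow> complex" where
  "overlap_weight u v X Y = (- 1) ^ card X * (\<Prod>i\<in>{1..n} - X. u + z i) * (\<Prod>i\<in>{1..n} - Y. v + z i)"

definition overlap_pairs :: "nat \<Rightarrow> nat \<Rightarrow> (nat set \<times> nat set) set" where
  "overlap_pairs r m = {(X, Y). X \<subseteq> {1..n} \<and> Y \<subseteq> {1..n} \<and> card X + card Y = m \<and> card (X \<inter> Y) = r}"

definition overlap_sum :: "nat \<Rightarrow> nat \<Rightarrow> complex \<Rightarrow> complex \<Rightarrow> nat perm \<Rightarrow>\<^sub>0 complex" where
  "overlap_sum r m u v = (\<Sum>(X, Y)\<in>overlap_pairs r m. scale (overlap_weight u v X Y) (alpha b X * alpha (\<not> b) Y))"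

lemma finite_subset_interval: "X \<subseteq> {1..n} \<Longrightarrow> finite X"
  by (rule finite_subset) auto

lemma finite_overlap_pairs: "finite (overlap_pairs r m)"
  by (rule finite_subset[of _ "Pow {1..n} \<times> Pow {1..n}"]) (auto simp: overlap_pairs_def)

text \<open>Pairs with two or more common points contribute zero, by
  \<open>alpha_mult_alpha_eq_0\<close>.\<close>

lemma alternating_beta_sum:
  "(\<Sum>k\<le>m. scale ((- 1) ^ k) (beta b n z k u * beta (\<not> b) n z (m - k) v)) =
     overlap_sum 0 m u v + overlap_sum 1 m u v"
proof -
  let ?N = "{1..n}"
  let ?h = "\<lambda>X Y. scale (overlap_weight u v X Y) (alpha b X * alpha (\<not> b) Y)"
  define A where "A = {(X, Y). X \<subseteq> ?N \<and> Y \<subseteq> ?N \<and> card X + card Y = m}"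
  have finA: "finite A"
    by (rule finite_subset[of _ "Pow {1..n} \<times> Pow {1..n}"]) (auto simp: A_def)
  have fin: "finite {X. X \<subseteq> ?N \<and> Q X}" for Q
    by (rule finite_subset[of _ "Pow {1..n}"]) auto
  have "(\<Sum>k\<le>m. scale ((- 1) ^ k) (beta b n z k u * beta (\<not> b) n z (m - k) v)) =
     (\<Sum>k\<le>m. \<Sum>X | X \<subseteq> ?N \<and> card X = k. \<Sum>Y | Y \<subseteq> ?N \<and> card Y = m - k. ?h X Y)"
    by (intro sum.cong refl)
      (simp add: beta_mult group_algebra.scale_sum_right overlap_weight_def mult.assoc)
  also have "\<dots> = (\<Sum>(k, X, Y)\<in>(SIGMA k:{..m}. {X. X \<subseteq> ?N \<and> card X = k} \<times> {Y. Y \<subseteq> ?N \<and> card Y = m - k}). ?h X Y)"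
    by (subst sum.Sigma[symmetric]) (auto simp: fin sum.cartesian_product)
  also have "\<dots> = (\<Sum>(X, Y)\<in>A. ?h X Y)"
    by (rule sum.reindex_bij_witness[of _ "\<lambda>(X, Y). (card X, X, Y)" "\<lambda>(k, X, Y). (X, Y)"])
      (auto simp: A_def)
  also have "\<dots> = (\<Sum>(X, Y)\<in>overlap_pairs 0 m \<union> overlap_pairs 1 m. ?h X Y)"
  proof (rule sum.mono_neutral_right[OF finA])
    show "\<forall>p\<in>A - (overlap_pairs 0 m \<union> overlap_pairs 1 m). (case p of (X, Y) \<Rightarrow> ?h X Y) = 0"
    proof
      fix p assume "p \<in> A - (overlap_pairs 0 m \<union> overlap_pairs 1 m)"
      then obtain X Y where p: "p = (X, Y)" "X \<subseteq> ?N" and c: "card (X \<inter> Y) \<noteq> 0" "card (X \<inter> Y) \<noteq> 1"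
        by (auto simp: A_def overlap_pairs_def)
      then have "\<not> is_singleton (X \<inter> Y)" "X \<inter> Y \<noteq> {}"
        by (auto simp: is_singleton_altdef)
      then obtain x y where "x \<in> X \<inter> Y" "y \<in> X \<inter> Y" "x \<noteq> y"
        by (metis is_singletonI')
      then show "(case p of (X, Y) \<Rightarrow> ?h X Y) = 0"
        using p by (simp add: alpha_mult_alpha_eq_0)
    qed
  qed (auto simp: A_def overlap_pairs_def)
  also have "\<dots> = overlap_sum 0 m u v + overlap_sum 1 m u v"
    unfolding overlap_sum_def by (rule sum.union_disjoint[OF finite_overlap_pairs finite_overlap_pairs]) (auto simp: overlap_pairs_def)
  finally show ?thesis .
qed

lemma overlap_weight_remove_left:
  assumes "X \<subseteq> {1..n}" "j \<in> X"
  shows "overlap_weight u v (X - {j}) Y = - (u + z j) * overlap_weight u v X Y"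
proof -
  have compl: "{1..n} - (X - {j}) = insert j ({1..n} - X)" using assms by auto
  have sign: "(- 1) ^ card (X - {j}) = - ((- 1) ^ card X :: complex)"
    by (subst card.remove[OF finite_subset_interval[OF assms(1)] assms(2)]) simp
  show ?thesis unfolding overlap_weight_def compl sign using assms by (simp add: algebra_simps)
qed

lemma overlap_weight_remove_right:
  assumes "Y \<subseteq> {1..n}" "j \<in> Y"
  shows "overlap_weight u v X (Y - {j}) = (v + z j) * overlap_weight u v X Y"
proof -
  have "{1..n} - (Y - {j}) = insert j ({1..n} - Y)" using assms by auto
  then show ?thesis using assms by (simp add: overlap_weight_def)
qed

text \<open>\<open>alpha_mult_alpha_disjoint\<close> expands each disjoint pair into pairs with
  exactly one common point \<open>j\<close>. Such a pair arises twice, by adding \<open>j\<close> to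
  \<open>X\<close> or to \<open>Y\<close>, with weights \<open>- (u + z j)\<close> and
  \<open>v + z j\<close> times its own; their sum \<open>v - u\<close> no longer depends on
  \<open>j\<close>.\<close>

lemma overlap_sum_recurrence:
  "scale (of_nat m) (overlap_sum 0 m u v) = scale (v - u) (overlap_sum 1 (Suc m) u v)"
proof -
  let ?N = "{1..n}"
  let ?g = "\<lambda>X Y. alpha b X * alpha (\<not> b) Y"
  define C where "C = {(X, Y, j). X \<subseteq> ?N \<and> Y \<subseteq> ?N \<and> card X + card Y = Suc m \<and> X \<inter> Y = {j}}"
  note fin = finite_subset_interval
  have disj: "X \<inter> Y = {}" "X \<subseteq> ?N" "Y \<subseteq> ?N" "finite X" "finite Y" "card X + card Y = m"
    if "(X, Y) \<in> overlap_pairs 0 m" for X Y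
    using that fin[of X] fin[of Y] by (auto simp: overlap_pairs_def)
  \<comment> \<open>In each term the factor \<open>m\<close> is written as
    \<open>card X + card Y\<close>, the multiple that \<open>alpha_mult_alpha_disjoint\<close>
    evaluates.\<close>
  have "scale (of_nat m) (overlap_sum 0 m u v) =
      (\<Sum>(X, Y)\<in>overlap_pairs 0 m. scale (overlap_weight u v X Y) (scale (of_nat (card X + card Y)) (?g X Y)))"
    unfolding overlap_sum_def group_algebra.scale_sum_right
    by (intro sum.cong refl) (auto dest!: disj(6) simp: mult.commute)
  also have "\<dots> = (\<Sum>(X, Y)\<in>overlap_pairs 0 m. scale (overlap_weight u v X Y)
      ((\<Sum>j\<in>Y. ?g (insert j X) Y) + (\<Sum>j\<in>X. ?g X (insert j Y))))"
    by (intro sum.cong refl, clarify, frule disj(1), frule disj(4), drule disj(5))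
      (simp only: alpha_mult_alpha_disjoint)
  also have "\<dots> = (\<Sum>(X, Y)\<in>overlap_pairs 0 m. \<Sum>j\<in>Y. scale (overlap_weight u v X Y) (?g (insert j X) Y)) +
      (\<Sum>(X, Y)\<in>overlap_pairs 0 m. \<Sum>j\<in>X. scale (overlap_weight u v X Y) (?g X (insert j Y)))"
    by (simp add: group_algebra.scale_right_distrib group_algebra.scale_sum_right sum.distrib split_def)
  also have "(\<Sum>(X, Y)\<in>overlap_pairs 0 m. \<Sum>j\<in>Y. scale (overlap_weight u v X Y) (?g (insert j X) Y)) =
      (\<Sum>(p, j)\<in>(SIGMA p:overlap_pairs 0 m. snd p). scale (overlap_weight u v (fst p) (snd p)) (?g (insert j (fst p)) (snd p)))"
    by (subst sum.Sigma[symmetric]) (auto simp: finite_overlap_pairs split_def dest: disj(5))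
  also have "\<dots> = (\<Sum>(X, Y, j)\<in>C. scale (overlap_weight u v (X - {j}) Y) (?g X Y))"
  proof (rule sum.reindex_bij_witness[of _ "\<lambda>(X, Y, j). ((X - {j}, Y), j)" "\<lambda>((X, Y), j). (insert j X, Y, j)"])
    fix a assume "a \<in> (SIGMA p:overlap_pairs 0 m. snd p)"
    then obtain X Y j where a: "a = ((X, Y), j)" "(X, Y) \<in> overlap_pairs 0 m" "j \<in> Y" by auto
    note d = disj[OF a(2)]
    have j: "j \<notin> X" using d a by auto
    then show "(\<lambda>(X, Y, j). ((X - {j}, Y), j)) ((\<lambda>((X, Y), j). (insert j X, Y, j)) a) = a"
      by (simp add: a(1))
    show "(\<lambda>((X, Y), j). (insert j X, Y, j)) a \<in> C"
      using d a(3) j by (auto simp: a(1) C_def)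
    show "(\<lambda>(X, Y, j). scale (overlap_weight u v (X - {j}) Y) (?g X Y)) ((\<lambda>((X, Y), j). (insert j X, Y, j)) a) =
        (case a of (p, j) \<Rightarrow> scale (overlap_weight u v (fst p) (snd p)) (?g (insert j (fst p)) (snd p)))"
      by (simp add: a(1) j)
  next
    fix c assume "c \<in> C"
    then obtain X Y j where c: "c = (X, Y, j)" "X \<subseteq> ?N" "Y \<subseteq> ?N" "card X + card Y = Suc m" "X \<inter> Y = {j}"
      by (auto simp: C_def)
    then have j: "j \<in> X" "j \<in> Y" by auto
    have "card X = Suc (card (X - {j}))" by (rule card.remove[OF fin[OF c(2)] j(1)])
    moreover have "(X - {j}) \<inter> Y = {}" using c(5) by auto
    ultimately show "(\<lambda>(X, Y, j). ((X - {j}, Y), j)) c \<in> (SIGMA p:overlap_pairs 0 m. snd p)"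
      using c j by (auto simp: overlap_pairs_def)
    show "(\<lambda>((X, Y), j). (insert j X, Y, j)) ((\<lambda>(X, Y, j). ((X - {j}, Y), j)) c) = c"
      using j by (auto simp: c(1))
  qed
  also have "(\<Sum>(X, Y)\<in>overlap_pairs 0 m. \<Sum>j\<in>X. scale (overlap_weight u v X Y) (?g X (insert j Y))) =
      (\<Sum>(p, j)\<in>(SIGMA p:overlap_pairs 0 m. fst p). scale (overlap_weight u v (fst p) (snd p)) (?g (fst p) (insert j (snd p))))"
    by (subst sum.Sigma[symmetric]) (auto simp: finite_overlap_pairs split_def dest: disj(4))
  also have "\<dots> = (\<Sum>(X, Y, j)\<in>C. scale (overlap_weight u v X (Y - {j})) (?g X Y))"
  proof (rule sum.reindex_bij_witness[of _ "\<lambda>(X, Y, j). ((X, Y - {j}), j)" "\<lambda>((X, Y), j). (X, insert j Y, j)"])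
    fix a assume "a \<in> (SIGMA p:overlap_pairs 0 m. fst p)"
    then obtain X Y j where a: "a = ((X, Y), j)" "(X, Y) \<in> overlap_pairs 0 m" "j \<in> X" by auto
    note d = disj[OF a(2)]
    have j: "j \<notin> Y" using d a by auto
    then show "(\<lambda>(X, Y, j). ((X, Y - {j}), j)) ((\<lambda>((X, Y), j). (X, insert j Y, j)) a) = a"
      by (simp add: a(1))
    show "(\<lambda>((X, Y), j). (X, insert j Y, j)) a \<in> C"
      using d a(3) j by (auto simp: a(1) C_def)
    show "(\<lambda>(X, Y, j). scale (overlap_weight u v X (Y - {j})) (?g X Y)) ((\<lambda>((X, Y), j). (X, insert j Y, j)) a) =
        (case a of (p, j) \<Rightarrow> scale (overlap_weight u v (fst p) (snd p)) (?g (fst p) (insert j (snd p))))"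
      by (simp add: a(1) j)
  next
    fix c assume "c \<in> C"
    then obtain X Y j where c: "c = (X, Y, j)" "X \<subseteq> ?N" "Y \<subseteq> ?N" "card X + card Y = Suc m" "X \<inter> Y = {j}"
      by (auto simp: C_def)
    then have j: "j \<in> X" "j \<in> Y" by auto
    have "card Y = Suc (card (Y - {j}))" by (rule card.remove[OF fin[OF c(3)] j(2)])
    moreover have "X \<inter> (Y - {j}) = {}" using c(5) by auto
    ultimately show "(\<lambda>(X, Y, j). ((X, Y - {j}), j)) c \<in> (SIGMA p:overlap_pairs 0 m. fst p)"
      using c j by (auto simp: overlap_pairs_def)
    show "(\<lambda>((X, Y), j). (X, insert j Y, j)) ((\<lambda>(X, Y, j). ((X, Y - {j}), j)) c) = c"
      using j by (auto simp: c(1))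
  qed
  also have "(\<Sum>(X, Y, j)\<in>C. scale (overlap_weight u v (X - {j}) Y) (?g X Y)) +
      (\<Sum>(X, Y, j)\<in>C. scale (overlap_weight u v X (Y - {j})) (?g X Y)) =
      (\<Sum>(X, Y, j)\<in>C. scale (v - u) (scale (overlap_weight u v X Y) (?g X Y)))"
    unfolding sum.distrib[symmetric]
  proof (intro sum.cong refl)
    fix c assume "c \<in> C"
    then obtain X Y j where c: "c = (X, Y, j)" "X \<subseteq> ?N" "Y \<subseteq> ?N" and "X \<inter> Y = {j}"
      by (auto simp: C_def)
    then have "j \<in> X" "j \<in> Y" by auto
    show "(case c of (X, Y, j) \<Rightarrow> scale (overlap_weight u v (X - {j}) Y) (?g X Y)) +
        (case c of (X, Y, j) \<Rightarrow> scale (overlap_weight u v X (Y - {j})) (?g X Y)) =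
        (case c of (X, Y, j) \<Rightarrow> scale (v - u) (scale (overlap_weight u v X Y) (?g X Y)))"
      using c \<open>j \<in> X\<close> \<open>j \<in> Y\<close> by (simp add: overlap_weight_remove_left overlap_weight_remove_right algebra_simps
          flip: group_algebra.scale_left_distrib)
  qed
  also have "\<dots> = (\<Sum>(X, Y)\<in>overlap_pairs 1 (Suc m). scale (v - u) (scale (overlap_weight u v X Y) (?g X Y)))"
    by (rule sum.reindex_bij_witness[of _ "\<lambda>(X, Y). (X, Y, the_elem (X \<inter> Y))" "\<lambda>(X, Y, j). (X, Y)"])
      (auto simp: C_def overlap_pairs_def card_1_singleton_iff)
  also have "\<dots> = scale (v - u) (overlap_sum 1 (Suc m) u v)"
    by (simp add: overlap_sum_def group_algebra.scale_sum_right split_def)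
  finally show ?thesis .
qed

text \<open>Strong induction on \<open>m\<close>. On the diagonal \<open>u = v\<close> the terms
  with disjoint supports drop out, so the alternating sum of degree \<open>m\<close> is
  \<open>overlap_sum 1 m v v\<close>. Its term \<open>k = 0\<close> is a multiple of the wanted
  element, and the others involve the opposite sign in lower degree only.\<close>

lemma beta_opposite_in_subalgebra:
  assumes V: "group_algebra.subspace V" and one: "1 \<in> V"
    and mult: "\<And>x y. x \<in> V \<Longrightarrow> y \<in> V \<Longrightarrow> x * y \<in> V" and beta: "\<And>k u. beta b n z k u \<in> V"
  shows "beta (\<not> b) n z m v \<in> V"
proof (induction m arbitrary: v rule: less_induct)
  case (less m)
  let ?N = "{1..n}"
  have fin: "finite {X. X \<subseteq> ?N \<and> Q X}" for Q
    by (rule finite_subset[of _ "Pow {1..n}"]) auto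
  have poly_factors: "poly (\<Prod>i\<in>S. [:z i, 1:]) u = (\<Prod>i\<in>S. u + z i)" for S u
    by (simp add: poly_prod add.commute)
  \<comment> \<open>Reaching degree \<open>Suc i\<close> takes the opposite \<open>beta\<close> only
    up to degree \<open>i\<close>, which is below \<open>m\<close>; so the induction hypothesis
    suffices up to degree \<open>m\<close> inclusive.\<close>
  have U: "overlap_sum 1 i u v \<in> V" if "i \<le> m" for i u v
    using that
  proof (induction i arbitrary: u v)
    case 0
    have "overlap_pairs 1 0 = {}"
      using finite_subset_interval by (fastforce simp: overlap_pairs_def)
    then show ?case using group_algebra.subspace_0[OF V] by (simp add: overlap_sum_def)
  next
    case (Suc i)
    \<comment> \<open>The alternating sum of degree \<open>i\<close> minus its one-point part leaves
      \<open>overlap_sum 0 i\<close>, which the recurrence turns into degree \<open>Suc i\<close>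
      after division by \<open>v - x\<close>.\<close>
    have off_diagonal: "overlap_sum 1 (Suc i) x v \<in> V" if "x \<noteq> v" for x
    proof -
      have "overlap_sum 0 i x v + overlap_sum 1 i x v \<in> V"
        unfolding alternating_beta_sum[symmetric]
        by (rule group_algebra.subspace_sum[OF V], rule group_algebra.subspace_scale[OF V], rule mult)
          (use Suc.prems in \<open>auto intro: beta less.IH\<close>)
      then have "overlap_sum 0 i x v \<in> V"
        using group_algebra.subspace_diff[OF V _ Suc.IH[of x v]] Suc.prems by fastforce
      then have "scale (v - x) (overlap_sum 1 (Suc i) x v) \<in> V"
        unfolding overlap_sum_recurrence[symmetric] by (rule group_algebra.subspace_scale[OF V])
      from group_algebra.subspace_scale[OF V this, of "1 / (v - x)"] that show ?thesis by simp
    qed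
    \<comment> \<open>For fixed \<open>v\<close> the overlap sum is a polynomial in
      \<open>x\<close>, so the missing value at \<open>x = v\<close> follows by
      interpolation.\<close>
    define q where "q p = smult ((- 1) ^ card (fst p) * (\<Prod>i\<in>?N - snd p. v + z i)) (\<Prod>i\<in>?N - fst p. [:z i, 1:])"
      for p :: "nat set \<times> nat set"
    have eq: "overlap_sum 1 (Suc i) x v =
        (\<Sum>p\<in>overlap_pairs 1 (Suc i). scale (poly (q p) x) (alpha b (fst p) * alpha (\<not> b) (snd p)))" for x
      by (simp add: overlap_sum_def q_def poly_factors overlap_weight_def split_def mult_ac)
    show ?case
      unfolding eq
    proof (rule group_algebra.polynomial_value_in_subspace[OF V _ finite_overlap_pairs])
      show "infinite (- {v})" by (simp add: finite_compl infinite_UNIV_char_0)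
    qed (use off_diagonal in \<open>simp only: eq[symmetric] Compl_iff singleton_iff\<close>)
  qed
  have beta_0: "beta c n z 0 v = scale (\<Prod>i\<in>?N. v + z i) 1" for c v
  proof -
    have "{X. X \<subseteq> ?N \<and> card X = 0} = {{}}" using finite_subset_interval by auto
    moreover have "alpha c {} = 1"
    proof -
      have "sym_group {} = {1}" by (auto simp: sym_group_def perm_eq_iff)
      then show ?thesis by (simp add: alpha_def one_eq_single_perm)
    qed
    ultimately show ?thesis by (simp add: beta_def)
  qed
  show ?case
  proof (cases "m = 0")
    case True
    then show ?thesis by (simp add: beta_0 one group_algebra.subspace_scale[OF V])
  next
    case False
    \<comment> \<open>The division by the scalar of \<open>beta b n z 0 v\<close> fails only at the
      finitely many points \<open>- z i\<close>, which interpolation covers afterwards.\<close>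
    have nonroot: "beta (\<not> b) n z m v \<in> V" if v: "(\<Prod>i\<in>?N. v + z i) \<noteq> 0" for v
    proof -
      let ?K = "\<lambda>I. \<Sum>k\<in>I. scale ((- 1) ^ k) (beta b n z k v * beta (\<not> b) n z (m - k) v)"
      \<comment> \<open>For \<open>u = v\<close> the right-hand side of the recurrence vanishes, and
        \<open>m \<noteq> 0\<close> can be cancelled.\<close>
      have "overlap_sum 0 m v v = 0"
        using overlap_sum_recurrence[of m v v] False by simp
      then have "?K {..m} \<in> V"
        using U[of m v v] by (simp add: alternating_beta_sum)
      moreover have "?K {..m} = scale (\<Prod>i\<in>?N. v + z i) (beta (\<not> b) n z m v) + ?K {1..m}"
        by (simp add: atMost_atLeast0 sum.atLeast_Suc_atMost beta_0 scale_mult_left)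
      moreover have "?K {1..m} \<in> V"
        by (rule group_algebra.subspace_sum[OF V], rule group_algebra.subspace_scale[OF V], rule mult)
          (auto intro: beta less.IH)
      ultimately have "scale (\<Prod>i\<in>?N. v + z i) (beta (\<not> b) n z m v) \<in> V"
        using group_algebra.subspace_diff[OF V, of "?K {..m}" "?K {1..m}"] by simp
      from group_algebra.subspace_scale[OF V this, of "1 / (\<Prod>i\<in>?N. v + z i)"] v show ?thesis by simp
    qed
    have eq: "beta (\<not> b) n z m x =
        (\<Sum>X | X \<subseteq> ?N \<and> card X = m. scale (poly (\<Prod>i\<in>?N - X. [:z i, 1:]) x) (alpha (\<not> b) X))" for x
      by (simp add: beta_def poly_factors)
    show ?thesis
      unfolding eq
    proof (rule group_algebra.polynomial_value_in_subspace[OF V _ fin])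
      have "(\<Prod>i\<in>?N. x + z i) \<noteq> 0 \<longleftrightarrow> x \<in> - ((\<lambda>i. - z i) ` ?N)" for x
        by (auto simp: add_eq_0_iff2)
      then show "infinite {x. (\<Prod>i\<in>?N. x + z i) \<noteq> 0}"
        by (simp add: finite_compl infinite_UNIV_char_0)
    qed (use nonroot in \<open>simp only: eq[symmetric] mem_Collect_eq\<close>)
  qed
qed

end

section \<open>From values at \<open>u\<close> to coefficients\<close>

definition beta_coeff :: "bool \<Rightarrow> nat \<Rightarrow> (nat \<Rightarrow> complex) \<Rightarrow> nat \<Rightarrow> nat \<Rightarrow> nat perm \<Rightarrow>\<^sub>0 complex" where
  "beta_coeff b n z k l = (\<Sum>(X, Y)\<in>disjoint_pairs n k l. scale (\<Prod>i\<in>Y. z i) (alpha b X))"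

text \<open>In the product over the complement of \<open>X\<close>, the set \<open>Y\<close>
  collects the points that contribute \<open>z i\<close>; the remaining
  \<open>n - k - card Y\<close> points contribute \<open>u\<close>, so \<open>u ^ i\<close> goes
  with \<open>card Y = n - k - i\<close>.\<close>

lemma beta_eq_sum_beta_coeff:
  assumes "k \<le> n"
  shows "beta b n z k u = (\<Sum>i\<le>n - k. scale (u ^ i) (beta_coeff b n z k (n - k - i)))"
proof -
  let ?N = "{1..n}"
  let ?h = "\<lambda>X Y. scale (u ^ (n - k - card Y)) (scale (\<Prod>i\<in>Y. z i) (alpha b X))"
  have fin: "finite X" if "X \<subseteq> ?N" for X using that by (rule finite_subset) auto
  have fin': "finite {X. X \<subseteq> ?N \<and> Q X}" for Q
    by (rule finite_subset[of _ "Pow {1..n}"]) auto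
  have card: "card (?N - X) = n - card X" if "X \<subseteq> ?N" for X
    using that fin[OF that] by (simp add: card_Diff_subset)
  have cardXY: "card X + card Y \<le> n" if "X \<subseteq> ?N" "Y \<subseteq> ?N - X" for X Y
    using card_mono[of "?N - X" Y] card_mono[of ?N X] that card[of X] by simp
  have "beta b n z k u = (\<Sum>X | X \<subseteq> ?N \<and> card X = k. \<Sum>Y\<in>Pow (?N - X). ?h X Y)"
    unfolding beta_def
  proof (intro sum.cong refl)
    fix X assume "X \<in> {X. X \<subseteq> ?N \<and> card X = k}"
    then have X: "X \<subseteq> ?N" "card X = k" by auto
    have "(\<Prod>i\<in>?N - X. u + z i) = (\<Sum>Y\<in>Pow (?N - X). (\<Prod>i\<in>Y. z i) * u ^ card (?N - X - Y))"
      by (simp add: prod_add add.commute[of u])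
    also have "\<dots> = (\<Sum>Y\<in>Pow (?N - X). u ^ (n - k - card Y) * (\<Prod>i\<in>Y. z i))"
    proof (intro sum.cong refl)
      fix Y assume "Y \<in> Pow (?N - X)"
      then have "card (?N - X - Y) = card (?N - X) - card Y"
        using fin[of Y] by (intro card_Diff_subset) auto
      then show "(\<Prod>i\<in>Y. z i) * u ^ card (?N - X - Y) = u ^ (n - k - card Y) * (\<Prod>i\<in>Y. z i)"
        using X card by simp
    qed
    finally show "scale (\<Prod>i\<in>?N - X. u + z i) (alpha b X) = (\<Sum>Y\<in>Pow (?N - X). ?h X Y)"
      by (simp add: group_algebra.scale_sum_left)
  qed
  also have "\<dots> = (\<Sum>(X, Y)\<in>(SIGMA X:{X. X \<subseteq> ?N \<and> card X = k}. Pow (?N - X)). ?h X Y)"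
    by (rule sum.Sigma) (auto simp: fin')
  also have "\<dots> = (\<Sum>(i, X, Y)\<in>(SIGMA i:{..n - k}. disjoint_pairs n k (n - k - i)). scale (u ^ i) (scale (\<Prod>i\<in>Y. z i) (alpha b X)))"
  proof (rule sum.reindex_bij_witness[of _ "\<lambda>(i, X, Y). (X, Y)" "\<lambda>(X, Y). (n - k - card Y, X, Y)"])
    fix a assume "a \<in> (SIGMA X:{X. X \<subseteq> ?N \<and> card X = k}. Pow (?N - X))"
    then obtain X Y where a: "a = (X, Y)" "X \<subseteq> ?N" "card X = k" "Y \<subseteq> ?N - X" by auto
    have "card Y = n - k - (n - k - card Y)" using cardXY[OF a(2,4)] a(3) by simp
    then show "(case a of (X, Y) \<Rightarrow> (n - k - card Y, X, Y)) \<in>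
        (SIGMA i:{..n - k}. disjoint_pairs n k (n - k - i))"
      using a by (auto simp: disjoint_pairs_def)
  qed (auto simp: disjoint_pairs_def)
  also have "\<dots> = (\<Sum>i\<le>n - k. scale (u ^ i) (beta_coeff b n z k (n - k - i)))"
    by (subst sum.Sigma[symmetric])
      (auto simp: finite_disjoint_pairs beta_coeff_def group_algebra.scale_sum_right split_def)
  finally show ?thesis .
qed

lemma beta_coeff_eq_0:
  assumes "n < k + l"
  shows "beta_coeff b n z k l = 0"
proof -
  have "disjoint_pairs n k l = {}"
  proof (rule equals0I)
    fix p assume "p \<in> disjoint_pairs n k l"
    then obtain X Y where "X \<subseteq> {1..n}" "Y \<subseteq> {1..n}" "card X = k" "card Y = l" "X \<inter> Y = {}"
      by (auto simp: disjoint_pairs_def)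
    moreover from this have "finite X" "finite Y" by (auto intro: finite_subset)
    ultimately have "k + l = card (X \<union> Y)" "card (X \<union> Y) \<le> card {1..n}"
      by (simp add: card_Un_disjoint, intro card_mono) auto
    then show False using assms by simp
  qed
  then show ?thesis by (simp add: beta_coeff_def)
qed

text \<open>One direction is the expansion in powers of \<open>u\<close>, the other extracts
  coefficients by interpolation. Indices beyond the range of the expansion give zero on either
  side.\<close>

lemma beta_in_subspace_iff:
  assumes V: "group_algebra.subspace V"
  shows "(\<forall>k u. beta b n z k u \<in> V) \<longleftrightarrow> (\<forall>k l. beta_coeff b n z k l \<in> V)"
proof safe
  fix k u assume V': "\<forall>k l. beta_coeff b n z k l \<in> V"
  show "beta b n z k u \<in> V"
  proof (cases "k \<le> n")
    case True
    show ?thesis unfolding beta_eq_sum_beta_coeff[OF True]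
      by (rule group_algebra.subspace_sum[OF V], rule group_algebra.subspace_scale[OF V]) (simp add: V')
  next
    case False
    then have "{X. X \<subseteq> {1..n} \<and> card X = k} = {}"
      using card_mono[of "{1..n}"] by fastforce
    then have "beta b n z k u = 0" unfolding beta_def by (simp only: sum.empty)
    then show ?thesis by (simp add: group_algebra.subspace_0[OF V])
  qed
next
  fix k l assume V': "\<forall>k u. beta b n z k u \<in> V"
  show "beta_coeff b n z k l \<in> V"
  proof (cases "k + l \<le> n")
    case True
    then have "k \<le> n" by simp
    have "beta_coeff b n z k (n - k - (n - k - l)) \<in> V"
    proof (rule group_algebra.polynomial_coeff_in_subspace[OF V infinite_UNIV_char_0,
          where c = "\<lambda>i. beta_coeff b n z k (n - k - i)" and d = "n - k" and r = "n - k - l"])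
      show "(\<Sum>i\<le>n - k. scale (u ^ i) (beta_coeff b n z k (n - k - i))) \<in> V" for u
        using V' by (simp only: beta_eq_sum_beta_coeff[OF \<open>k \<le> n\<close>, symmetric])
    qed simp
    then show ?thesis using True by simp
  qed (simp add: beta_coeff_eq_0 group_algebra.subspace_0[OF V])
qed

text \<open>This makes \<open>beta_in_subspace_iff\<close> applicable to commutation: commuting with
  all values is the same as commuting with all coefficients.\<close>

lemma subspace_centralizer: "group_algebra.subspace {x. a * x = x * a}"
  by (rule group_algebra.subspaceI) (auto simp: distrib_left distrib_right scale_mult_left scale_mult_right)

text \<open>Pass from values to coefficients in one factor, then in the other.\<close>

lemma beta_coeff_commute:
  "beta_coeff b n z k l * beta_coeff b n z k' l' = beta_coeff b n z k' l' * beta_coeff b n z k l"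
proof -
  have "beta b n z m v * beta_coeff b n z k l = beta_coeff b n z k l * beta b n z m v" for m v
    using beta_in_subspace_iff[OF subspace_centralizer[of "beta b n z m v"], of b n z] beta_commute by auto
  then show ?thesis
    using beta_in_subspace_iff[OF subspace_centralizer[of "beta_coeff b n z k l"], of b n z] by auto
qed

section \<open>The generated subalgebras\<close>

definition Bethe_subalgebra :: "bool \<Rightarrow> nat \<Rightarrow> (nat \<Rightarrow> complex) \<Rightarrow> (nat perm \<Rightarrow>\<^sub>0 complex) set" where
  "Bethe_subalgebra b n z = generated_subalgebra n {beta_coeff b n z k l |k l. k \<le> n \<and> l \<le> n}"

lemma beta_plus_eq: "beta_plus n z = beta_coeff True n z"
  by (simp add: fun_eq_iff beta_plus_def beta_coeff_def alpha_plus_def alpha_def chi_def)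

lemma beta_minus_eq: "beta_minus n z = beta_coeff False n z"
  by (simp add: fun_eq_iff beta_minus_def beta_coeff_def alpha_minus_def alpha_def chi_def)

lemma beta_coeff_in_group_algebra: "beta_coeff b n z k l \<in> group_algebra n"
  using beta_plus_in_group_algebra[of n z k l] beta_minus_in_group_algebra[of n z k l]
  by (cases b) (simp_all add: beta_plus_eq beta_minus_eq)

lemma subspace_subalgebra:
  assumes "subalgebra n V"
  shows "group_algebra.subspace V"
proof (rule group_algebra.subspaceI)
  have "scale 0 1 \<in> V" using assms unfolding subalgebra_def by blast
  then show "0 \<in> V" by (simp only: group_algebra.scale_zero_left)
qed (use assms in \<open>auto simp: subalgebra_def\<close>)

lemma subalgebra_Bethe_subalgebra: "subalgebra n (Bethe_subalgebra b n z)"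
  unfolding Bethe_subalgebra_def
  by (rule subalgebra_generated_subalgebra) (auto simp: beta_coeff_in_group_algebra)

text \<open>The generators of sign \<open>b\<close> yield the values of \<open>beta b\<close>, these
  yield the values of the opposite sign by \<open>beta_opposite_in_subalgebra\<close>, and
  interpolation returns to coefficients.\<close>

lemma beta_coeff_in_Bethe_subalgebra: "beta_coeff c n z k l \<in> Bethe_subalgebra b n z"
proof -
  let ?V = "Bethe_subalgebra b n z"
  note sub = subalgebra_Bethe_subalgebra[of n b z]
  note V = subspace_subalgebra[OF sub]
  have same: "beta_coeff b n z k l \<in> ?V" for k l
  proof (cases "k \<le> n \<and> l \<le> n")
    case True
    then have "beta_coeff b n z k l \<in> {beta_coeff b n z k l |k l. k \<le> n \<and> l \<le> n}" by blast
    then show ?thesis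
      unfolding Bethe_subalgebra_def generated_subalgebra_def by (rule hull_inc)
  next
    case False
    then show ?thesis using group_algebra.subspace_0[OF V] by (auto simp: beta_coeff_eq_0)
  qed
  then have "beta b n z k u \<in> ?V" for k u
    using beta_in_subspace_iff[OF V] by blast
  then have "beta (\<not> b) n z k u \<in> ?V" for k u
    by (intro beta_opposite_in_subalgebra[OF V]) (use sub in \<open>auto simp: subalgebra_def\<close>)
  then have "beta_coeff (\<not> b) n z k l \<in> ?V" for k l
    using beta_in_subspace_iff[OF V] by blast
  then show ?thesis using same by (cases "c = b") auto
qed

lemma Bethe_subalgebra_subset:
  assumes "subalgebra n V" "\<And>k l. beta_coeff b n z k l \<in> V"
  shows "Bethe_subalgebra b n z \<subseteq> V"
  unfolding Bethe_subalgebra_def generated_subalgebra_def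
  by (rule hull_minimal) (use assms in auto)

text \<open>The centralizer of a coefficient of sign \<open>b\<close> contains all coefficients of
  sign \<open>b\<close>, hence the subalgebra they generate, and with it the coefficients of either
  sign.\<close>

lemma beta_coeff_commute_all:
  "beta_coeff b n z k l * beta_coeff c n z k' l' = beta_coeff c n z k' l' * beta_coeff b n z k l"
proof -
  let ?a = "beta_coeff b n z k l"
  have "?a * (x * y) = x * y * ?a" if "?a * x = x * ?a" "?a * y = y * ?a" for x y
    using that by (metis mult.assoc)
  then have "subalgebra n (group_algebra n \<inter> {x. ?a * x = x * ?a})"
    using subalgebra_group_algebra[of n]
    by (auto simp: subalgebra_def distrib_left distrib_right scale_mult_left scale_mult_right)
  then have "Bethe_subalgebra b n z \<subseteq> group_algebra n \<inter> {x. ?a * x = x * ?a}"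
    by (rule Bethe_subalgebra_subset) (auto simp: beta_coeff_in_group_algebra beta_coeff_commute)
  then show ?thesis using beta_coeff_in_Bethe_subalgebra[of c n z k' l' b] by auto
qed

theorem theorem3p1:
  fixes n :: nat and z :: "nat \<Rightarrow> complex"
  assumes "n \<ge> 1"
  shows "(\<forall>a \<in> betas_plus n z \<union> betas_minus n z. \<forall>b \<in> betas_plus n z \<union> betas_minus n z.
            a * b = b * a) \<and>
         B_minus n z = B_plus n z \<and> B_plus n z = B_all n z"
proof -
  have plus: "B_plus n z = Bethe_subalgebra True n z" and minus: "B_minus n z = Bethe_subalgebra False n z"
    by (simp_all add: B_plus_def B_minus_def Bethe_subalgebra_def betas_plus_def betas_minus_def
        beta_plus_eq beta_minus_eq)
  have "Bethe_subalgebra b n z \<subseteq> Bethe_subalgebra c n z" for b c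
    by (rule Bethe_subalgebra_subset[OF subalgebra_Bethe_subalgebra beta_coeff_in_Bethe_subalgebra])
  then have "B_minus n z = B_plus n z" by (auto simp: plus minus)
  moreover have "B_plus n z = B_all n z"
  proof
    show "B_plus n z \<subseteq> B_all n z"
      unfolding B_plus_def B_all_def generated_subalgebra_def by (rule hull_mono) simp
    show "B_all n z \<subseteq> B_plus n z"
      unfolding B_all_def generated_subalgebra_def
      by (rule hull_minimal)
        (auto simp: plus betas_plus_def betas_minus_def beta_plus_eq beta_minus_eq
          beta_coeff_in_Bethe_subalgebra subalgebra_Bethe_subalgebra)
  qed
  moreover have "a * b = b * a"
    if "a \<in> betas_plus n z \<union> betas_minus n z" "b \<in> betas_plus n z \<union> betas_minus n z" for a b
    using that by (auto simp: betas_plus_def betas_minus_def beta_plus_eq beta_minus_eq beta_coeff_commute_all)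
  ultimately show ?thesis by blast
qed

end
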